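(* Let $H$ be a finite-dimensional Hilbert space, let $n\ge1$, and let $R,G:H\Rightarrow W_L;W_R$ be two nondegenerate measurements in $\mathbf{2Hilb}$ with outcomes in $\mathbf{Hilb}^n$. The (vertically unitary) preparation–measurement composite $G\cdot R^\dagger:W_L;W_R\Rightarrow W_L;W_R$ involves a pair of complementary observables, i.e. $R$ and $G$ are complementary, if and only if $G\cdot R^\dagger$ is horizontally unitary up to a scalar factor.
   Context: $\mathbf{2Hilb}$ is the 2-category of finite-dimensional 2-Hilbert spaces in matrix form: objects are $\mathbf{Hilb}^n$, $n\in\mathbb{N}$; a 1-cell $\mathbf{Hilb}^n\to\mathbf{Hilb}^m$ is an $m\times n$ matrix of finite-dimensional Hilbert spaces, composed by matrix multiplication with $\oplus$ and $\otimes$; a 2-cell $F\Rightarrow G$ is a matrix of linear maps $F_{i,j}\to G_{i,j}$; vertical composition $\cdot$ is entrywise and horizontal composition is induced by $\oplus$ and $\otimes$; $\dagger$ takes entrywise adjoints, and a 2-cell is (vertically) unitary if it is inverse to its $\dagger$. A 1-cell $\mathbf{Hilb}\to\mathbf{Hilb}$ is a Hilbert space. $X;Y$ denotes "first $X$, then $Y$" for 1-cells, and the corresponding horizontal composite for 2-cells; coherence isomorphisms are suppressed. The canonical witness of $\mathbf{Hilb}^n$: $W_L:\mathbf{Hilb}\to\mathbf{Hilb}^n$ and $W_R:\mathbf{Hilb}^n\to\mathbf{Hilb}$ are the column and row matrices with $n$ entries $\mathbb{C}$; $\mathrm{Copy}:\mathrm{id}_{\mathbf{Hilb}^n}\Rightarrow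 W_R;W_L$ has diagonal entries $1:\mathbb{C}\to\mathbb{C}$ and off-diagonal entries $0\to\mathbb{C}$; $\mathrm{Compare}=\mathrm{Copy}^\dagger$. A nondegenerate measurement on $H$ with outcomes in $\mathbf{Hilb}^n$ is a unitary 2-cell $M:H\Rightarrow W_L;W_R=\mathbb{C}^n$; it corresponds to the ordered orthonormal basis $M^{-1}(e_i)$, $i=1,\ldots,n$, of $H$. Two nondegenerate measurements $R,G$, with bases $a_i=R^{-1}(e_i)$ and $b_j=G^{-1}(e_j)$, are complementary if $|\langle a_i|b_j\rangle|^2=\frac1{\dim H}$ for all $i,j$. A 2-cell $K:W_L;W_R\Rightarrow W_L;W_R$ is horizontally unitary if the 2-cell obtained by bending its upper-left and lower-right wires, $$(\mathrm{Compare};\mathrm{id}_{W_R;W_L})\cdot(\mathrm{id}_{W_R};K;\mathrm{id}_{W_L})\cdot(\mathrm{id}_{W_R;W_L};\mathrm{Copy}):\ W_R;W_L\Rightarrow W_R;W_L,$$ is unitary; it is horizontally unitary up to a scalar factor if $\lambda K$ is horizontally unitary for some nonzero $\lambda\in\mathbb{C}$. *)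

theory Defs
  imports Complex_Main "HOL-Library.Function_Algebras"
begin

section \<open>Complex vector spaces\<close>

class complex_vector = ab_group_add +
  fixes scaleC :: "complex \<Rightarrow> 'a \<Rightarrow> 'a"  (infixr \<open>*\<^sub>C\<close> 75)
  assumes scaleC_add_right: "a *\<^sub>C (x + y) = a *\<^sub>C x + a *\<^sub>C y"
    and scaleC_add_left: "(a + b) *\<^sub>C x = a *\<^sub>C x + b *\<^sub>C x"
    and scaleC_scaleC: "a *\<^sub>C b *\<^sub>C x = (a * b) *\<^sub>C x"
    and scaleC_one: "1 *\<^sub>C x = x"

global_interpretation complex_vector: vector_space "scaleC :: complex \<Rightarrow> 'a \<Rightarrow> 'a::complex_vector"
  defines cspan = complex_vector.span
    and csubspace = complex_vector.subspace
    and cdim = complex_vector.dim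
  by unfold_locales
    (simp_all add: scaleC_add_right scaleC_add_left scaleC_scaleC scaleC_one)

instantiation complex :: complex_vector
begin
definition scaleC_complex :: "complex \<Rightarrow> complex \<Rightarrow> complex"
  where "scaleC_complex c z = c * z"
instance
  by intro_classes (simp_all add: scaleC_complex_def algebra_simps)
end

instantiation "fun" :: (type, complex_vector) complex_vector
begin
definition scaleC_fun :: "complex \<Rightarrow> ('a \<Rightarrow> 'b) \<Rightarrow> 'a \<Rightarrow> 'b"
  where "scaleC_fun c f = (\<lambda>x. c *\<^sub>C f x)"
instance
  by intro_classes
    (simp_all add: scaleC_fun_def plus_fun_def scaleC_add_right scaleC_add_left scaleC_scaleC scaleC_one)
end


section \<open>Finite-dimensional Hilbert spaces\<close>

text \<open>A Hilbert space consists of a subspace of an ambient complex vector space together with an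
  inner product on it, so that the entries of a matrix of Hilbert spaces can have different
  dimensions. Inner products are antilinear in the first argument. All maps between
  Hilbert spaces are extended by 0 outside their domain, so that equality of maps is equality
  of HOL functions.\<close>

record 'a hspace =
  carr :: "'a set"
  inn :: "'a \<Rightarrow> 'a \<Rightarrow> complex"

definition fd_hilbert :: "'a::complex_vector hspace \<Rightarrow> bool" where
  "fd_hilbert H \<longleftrightarrow>
     csubspace (carr H) \<and>
     (\<exists>B. finite B \<and> cspan B = carr H) \<and>
     (\<forall>x\<in>carr H. \<forall>y\<in>carr H. inn H y x = cnj (inn H x y)) \<and>
     (\<forall>x\<in>carr H. \<forall>y\<in>carr H. \<forall>z\<in>carr H. inn H x (y + z) = inn H x y + inn H x z) \<and>
     (\<forall>x\<in>carr H. \<forall>y\<in>carr H. \<forall>c. inn H x (c *\<^sub>C y) = c * inn H x y) \<and>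
     (\<forall>x\<in>carr H. x \<noteq> 0 \<longrightarrow> Im (inn H x x) = 0 \<and> Re (inn H x x) > 0)"

definition hdim :: "'a::complex_vector hspace \<Rightarrow> nat" where
  "hdim H = cdim (carr H)"

definition restr :: "'a hspace \<Rightarrow> ('a \<Rightarrow> 'b::zero) \<Rightarrow> 'a \<Rightarrow> 'b" where
  "restr H f = (\<lambda>x. if x \<in> carr H then f x else 0)"

definition linear_maps :: "'a::complex_vector hspace \<Rightarrow> 'b::complex_vector hspace \<Rightarrow> ('a \<Rightarrow> 'b) set" where
  "linear_maps H K = {f.
     (\<forall>x\<in>carr H. f x \<in> carr K) \<and>
     (\<forall>x\<in>carr H. \<forall>y\<in>carr H. f (x + y) = f x + f y) \<and>
     (\<forall>x\<in>carr H. \<forall>c. f (c *\<^sub>C x) = c *\<^sub>C f x) \<and>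
     (\<forall>x. x \<notin> carr H \<longrightarrow> f x = 0)}"

definition antilinear_maps :: "'a::complex_vector hspace \<Rightarrow> 'b::complex_vector hspace \<Rightarrow> ('a \<Rightarrow> 'b) set" where
  "antilinear_maps H K = {f.
     (\<forall>x\<in>carr H. f x \<in> carr K) \<and>
     (\<forall>x\<in>carr H. \<forall>y\<in>carr H. f (x + y) = f x + f y) \<and>
     (\<forall>x\<in>carr H. \<forall>c. f (c *\<^sub>C x) = cnj c *\<^sub>C f x) \<and>
     (\<forall>x. x \<notin> carr H \<longrightarrow> f x = 0)}"

definition adj :: "'a::complex_vector hspace \<Rightarrow> 'b::complex_vector hspace \<Rightarrow> ('a \<Rightarrow> 'b) \<Rightarrow> 'b \<Rightarrow> 'a" where
  "adj H K f = restr K (\<lambda>y. THE x. x \<in> carr H \<and> (\<forall>z\<in>carr H. inn H x z = inn K y (f z)))"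

definition is_onb :: "'a::complex_vector hspace \<Rightarrow> 'a set \<Rightarrow> bool" where
  "is_onb H B \<longleftrightarrow> finite B \<and> cspan B = carr H \<and>
     (\<forall>x\<in>B. \<forall>y\<in>B. inn H x y = (if x = y then 1 else 0))"

definition hilb_C :: "complex hspace" where
  "hilb_C = \<lparr>carr = UNIV, inn = (\<lambda>x y. cnj x * y)\<rparr>"

definition hilb_zero :: "'a::complex_vector hspace" where
  "hilb_zero = \<lparr>carr = {0}, inn = (\<lambda>x y. 0)\<rparr>"

text \<open>The tensor product of \<open>H\<close> and \<open>K\<close> is realised as the space of antilinear maps from \<open>H\<close> to
  \<open>K\<close>, with \<open>x \<otimes> y\<close> being the map \<open>z \<mapsto> \<langle>z|x\<rangle> y\<close>. The inner product is independent of the chosen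
  orthonormal basis and satisfies \<open>\<langle>x \<otimes> y|x' \<otimes> y'\<rangle> = \<langle>x|x'\<rangle> \<langle>y|y'\<rangle>\<close>.\<close>

definition tensor :: "'a::complex_vector hspace \<Rightarrow> 'b::complex_vector hspace \<Rightarrow> ('a \<Rightarrow> 'b) hspace" where
  "tensor H K = \<lparr>carr = antilinear_maps H K,
     inn = (\<lambda>S T. \<Sum>e\<in>(SOME B. is_onb H B). inn K (S e) (T e))\<rparr>"

definition pure :: "'a::complex_vector hspace \<Rightarrow> 'a \<Rightarrow> 'b::complex_vector \<Rightarrow> 'a \<Rightarrow> 'b" where
  "pure H x y = restr H (\<lambda>z. inn H z x *\<^sub>C y)"

text \<open>The tensor product of \<open>f: H \<rightarrow> H'\<close> and \<open>g: K \<rightarrow> K'\<close>. Since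
  \<open>\<langle>f\<^sup>\<dagger> z|x\<rangle> = \<langle>z|f x\<rangle>\<close>, it sends \<open>x \<otimes> y\<close> to \<open>f x \<otimes> g y\<close>.\<close>

definition tensor_map :: "'a::complex_vector hspace \<Rightarrow> 'c::complex_vector hspace \<Rightarrow>
    ('a \<Rightarrow> 'c) \<Rightarrow> ('b \<Rightarrow> 'd::complex_vector) \<Rightarrow> ('a \<Rightarrow> 'b) \<Rightarrow> ('c \<Rightarrow> 'd)" where
  "tensor_map H H' f g T = restr H' (\<lambda>z. g (T (adj H H' f z)))"

definition dsum :: "nat \<Rightarrow> (nat \<Rightarrow> 'a::complex_vector hspace) \<Rightarrow> (nat \<Rightarrow> 'a) hspace" where
  "dsum m V = \<lparr>carr = {v. (\<forall>k<m. v k \<in> carr (V k)) \<and> (\<forall>k\<ge>m. v k = 0)},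
     inn = (\<lambda>v w. \<Sum>k<m. inn (V k) (v k) (w k))\<rparr>"

definition summand :: "nat \<Rightarrow> 'a::zero \<Rightarrow> nat \<Rightarrow> 'a" where
  "summand k v = (\<lambda>k'. if k' = k then v else 0)"


section \<open>The 2-category of finite-dimensional 2-Hilbert spaces\<close>

text \<open>The object \<open>Hilb\<^sup>n\<close> is represented by the number \<open>n\<close>. A 1-cell from \<open>Hilb\<^sup>n\<close> to \<open>Hilb\<^sup>m\<close> is an
  \<open>m \<times> n\<close> matrix; \<open>ent F i j\<close> is the entry in row \<open>i < m\<close> and column \<open>j < n\<close>.\<close>

record 'a cell1 =
  src :: nat
  tgt :: nat
  ent :: "nat \<Rightarrow> nat \<Rightarrow> 'a hspace"

definition is_cell1 :: "'a::complex_vector cell1 \<Rightarrow> bool" where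
  "is_cell1 F \<longleftrightarrow> (\<forall>i<tgt F. \<forall>j<src F. fd_hilbert (ent F i j))"

definition id1 :: "nat \<Rightarrow> complex cell1" where
  "id1 n = \<lparr>src = n, tgt = n, ent = (\<lambda>i j. if i = j then hilb_C else hilb_zero)\<rparr>"

text \<open>\<open>F ;\<^sub>1 G\<close> is first \<open>F\<close>, then \<open>G\<close>, i.e. the matrix product \<open>G F\<close>.\<close>

definition comp1 :: "'a::complex_vector cell1 \<Rightarrow> 'b::complex_vector cell1 \<Rightarrow> (nat \<Rightarrow> 'b \<Rightarrow> 'a) cell1"
    (infixl \<open>;\<^sub>1\<close> 65) where
  "F ;\<^sub>1 G = \<lparr>src = src F, tgt = tgt G,
     ent = (\<lambda>i k. dsum (tgt F) (\<lambda>j. tensor (ent G i j) (ent F j k)))\<rparr>"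

record ('a, 'b) cell2 =
  dom2 :: "'a cell1"
  cod2 :: "'b cell1"
  map2 :: "nat \<Rightarrow> nat \<Rightarrow> 'a \<Rightarrow> 'b"

definition is_cell2 :: "('a::complex_vector, 'b::complex_vector) cell2 \<Rightarrow> bool" where
  "is_cell2 \<alpha> \<longleftrightarrow> is_cell1 (dom2 \<alpha>) \<and> is_cell1 (cod2 \<alpha>) \<and>
     src (dom2 \<alpha>) = src (cod2 \<alpha>) \<and> tgt (dom2 \<alpha>) = tgt (cod2 \<alpha>) \<and>
     (\<forall>i<tgt (dom2 \<alpha>). \<forall>j<src (dom2 \<alpha>).
        map2 \<alpha> i j \<in> linear_maps (ent (dom2 \<alpha>) i j) (ent (cod2 \<alpha>) i j))"

text \<open>Equality of 2-cells only concerns the entries inside the matrix.\<close>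

definition eq2 :: "('a, 'b) cell2 \<Rightarrow> ('a, 'b) cell2 \<Rightarrow> bool" where
  "eq2 \<alpha> \<beta> \<longleftrightarrow> dom2 \<alpha> = dom2 \<beta> \<and> cod2 \<alpha> = cod2 \<beta> \<and>
     (\<forall>i<tgt (dom2 \<alpha>). \<forall>j<src (dom2 \<alpha>). map2 \<alpha> i j = map2 \<beta> i j)"

definition id2 :: "'a::zero cell1 \<Rightarrow> ('a, 'a) cell2" where
  "id2 F = \<lparr>dom2 = F, cod2 = F, map2 = (\<lambda>i j. restr (ent F i j) (\<lambda>x. x))\<rparr>"

text \<open>\<open>\<beta> \<cdot> \<alpha>\<close> is first \<open>\<alpha>\<close>, then \<open>\<beta>\<close>.\<close>

definition vcomp :: "('b, 'c) cell2 \<Rightarrow> ('a, 'b) cell2 \<Rightarrow> ('a, 'c) cell2"  (infixr \<open>\<cdot>\<close> 60) where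
  "\<beta> \<cdot> \<alpha> = \<lparr>dom2 = dom2 \<alpha>, cod2 = cod2 \<beta>, map2 = (\<lambda>i j. map2 \<beta> i j \<circ> map2 \<alpha> i j)\<rparr>"

definition hcomp :: "('a::complex_vector, 'a'::complex_vector) cell2 \<Rightarrow>
    ('b::complex_vector, 'b'::complex_vector) cell2 \<Rightarrow> (nat \<Rightarrow> 'b \<Rightarrow> 'a, nat \<Rightarrow> 'b' \<Rightarrow> 'a') cell2"
    (infixl \<open>;\<^sub>2\<close> 65) where
  "\<alpha> ;\<^sub>2 \<beta> = \<lparr>dom2 = dom2 \<alpha> ;\<^sub>1 dom2 \<beta>, cod2 = cod2 \<alpha> ;\<^sub>1 cod2 \<beta>,
     map2 = (\<lambda>i k. restr (ent (dom2 \<alpha> ;\<^sub>1 dom2 \<beta>) i k)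
       (\<lambda>T j. if j < tgt (dom2 \<alpha>)
              then tensor_map (ent (dom2 \<beta>) i j) (ent (cod2 \<beta>) i j) (map2 \<beta> i j) (map2 \<alpha> j k) (T j)
              else 0))\<rparr>"

definition dagger :: "('a::complex_vector, 'b::complex_vector) cell2 \<Rightarrow> ('b, 'a) cell2"
    (\<open>_\<^sup>\<dagger>\<close> [1000] 1000) where
  "\<alpha>\<^sup>\<dagger> = \<lparr>dom2 = cod2 \<alpha>, cod2 = dom2 \<alpha>,
     map2 = (\<lambda>i j. adj (ent (dom2 \<alpha>) i j) (ent (cod2 \<alpha>) i j) (map2 \<alpha> i j))\<rparr>"

definition scale2 :: "complex \<Rightarrow> ('a, 'b::complex_vector) cell2 \<Rightarrow> ('a, 'b) cell2" where
  "scale2 c \<alpha> = \<lparr>dom2 = dom2 \<alpha>, cod2 = cod2 \<alpha>, map2 = (\<lambda>i j x. c *\<^sub>C map2 \<alpha> i j x)\<rparr>"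

definition unitary2 :: "('a::complex_vector, 'b::complex_vector) cell2 \<Rightarrow> bool" where
  "unitary2 \<alpha> \<longleftrightarrow> is_cell2 \<alpha> \<and>
     eq2 (\<alpha>\<^sup>\<dagger> \<cdot> \<alpha>) (id2 (dom2 \<alpha>)) \<and> eq2 (\<alpha> \<cdot> \<alpha>\<^sup>\<dagger>) (id2 (cod2 \<alpha>))"


subsection \<open>Coherence isomorphisms\<close>

text \<open>All of these are unitary, so their inverses are their daggers.
  \<open>unit_src F: F \<Rightarrow> id ; F\<close> sends \<open>v\<close> in the entry \<open>(i, j)\<close> to \<open>v \<otimes> 1\<close> in summand \<open>j\<close>;
  \<open>unit_tgt F: F \<Rightarrow> F ; id\<close> sends it to \<open>1 \<otimes> v\<close> in summand \<open>i\<close>.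
  \<open>assoc F G K: F ; (G ; K) \<Rightarrow> (F ; G) ; K\<close> is induced by \<open>(x \<otimes> y) \<otimes> z \<mapsto> x \<otimes> (y \<otimes> z)\<close> for
  \<open>x\<close>, \<open>y\<close>, \<open>z\<close> in entries of \<open>K\<close>, \<open>G\<close>, \<open>F\<close>, together with the exchange of the two direct sums: in
  terms of antilinear maps it is a form of currying.\<close>

definition unit_src :: "'a::complex_vector cell1 \<Rightarrow> ('a, nat \<Rightarrow> 'a \<Rightarrow> complex) cell2" where
  "unit_src F = \<lparr>dom2 = F, cod2 = id1 (src F) ;\<^sub>1 F,
     map2 = (\<lambda>i j. restr (ent F i j) (\<lambda>v. summand j (pure (ent F i j) v 1)))\<rparr>"

definition unit_tgt :: "'a::complex_vector cell1 \<Rightarrow> ('a, nat \<Rightarrow> complex \<Rightarrow> 'a) cell2" where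
  "unit_tgt F = \<lparr>dom2 = F, cod2 = F ;\<^sub>1 id1 (tgt F),
     map2 = (\<lambda>i j. restr (ent F i j) (\<lambda>v. summand i (pure hilb_C 1 v)))\<rparr>"

definition assoc :: "'a::complex_vector cell1 \<Rightarrow> 'b::complex_vector cell1 \<Rightarrow> 'c::complex_vector cell1 \<Rightarrow>
    (nat \<Rightarrow> (nat \<Rightarrow> 'c \<Rightarrow> 'b) \<Rightarrow> 'a, nat \<Rightarrow> 'c \<Rightarrow> nat \<Rightarrow> 'b \<Rightarrow> 'a) cell2" where
  "assoc F G K = \<lparr>dom2 = F ;\<^sub>1 (G ;\<^sub>1 K), cod2 = (F ;\<^sub>1 G) ;\<^sub>1 K,
     map2 = (\<lambda>i j. restr (ent (F ;\<^sub>1 (G ;\<^sub>1 K)) i j)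
       (\<lambda>U k x b y.
          if k < tgt G \<and> b < tgt F \<and> x \<in> carr (ent K i k) \<and> y \<in> carr (ent G k b)
          then U b (summand k (pure (ent K i k) x y)) else 0))\<rparr>"


section \<open>Measurements, complementarity and horizontal unitarity\<close>

definition W\<^sub>L :: "nat \<Rightarrow> complex cell1" where
  "W\<^sub>L n = \<lparr>src = 1, tgt = n, ent = (\<lambda>i j. hilb_C)\<rparr>"

definition W\<^sub>R :: "nat \<Rightarrow> complex cell1" where
  "W\<^sub>R n = \<lparr>src = n, tgt = 1, ent = (\<lambda>i j. hilb_C)\<rparr>"

text \<open>Every entry of \<open>W\<^sub>R ; W\<^sub>L\<close> is the one-summand sum of \<open>\<complex> \<otimes> \<complex>\<close>, identified with
  \<open>\<complex>\<close> via \<open>z \<mapsto> z \<otimes> 1\<close>.\<close>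

definition Copy :: "nat \<Rightarrow> (complex, nat \<Rightarrow> complex \<Rightarrow> complex) cell2" where
  "Copy n = \<lparr>dom2 = id1 n, cod2 = W\<^sub>R n ;\<^sub>1 W\<^sub>L n,
     map2 = (\<lambda>i j. if i = j then (\<lambda>z. summand 0 (pure hilb_C z 1)) else (\<lambda>z. 0))\<rparr>"

definition Compare :: "nat \<Rightarrow> (nat \<Rightarrow> complex \<Rightarrow> complex, complex) cell2" where
  "Compare n = (Copy n)\<^sup>\<dagger>"

definition hilb_cell :: "'a hspace \<Rightarrow> 'a cell1" where
  "hilb_cell H = \<lparr>src = 1, tgt = 1, ent = (\<lambda>i j. H)\<rparr>"

definition measurement ::
    "nat \<Rightarrow> 'a::complex_vector hspace \<Rightarrow> ('a, nat \<Rightarrow> complex \<Rightarrow> complex) cell2 \<Rightarrow> bool" where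
  "measurement n H M \<longleftrightarrow> dom2 M = hilb_cell H \<and> cod2 M = W\<^sub>L n ;\<^sub>1 W\<^sub>R n \<and> unitary2 M"

text \<open>The single entry of \<open>W\<^sub>L ; W\<^sub>R\<close> is the sum of \<open>n\<close> copies of \<open>\<complex> \<otimes> \<complex>\<close>, identified with
  \<open>\<complex>\<^sup>n\<close>; its \<open>i\<close>-th standard basis vector is \<open>1 \<otimes> 1\<close> in summand \<open>i\<close> (counted from 0).\<close>

definition std_vec :: "nat \<Rightarrow> nat \<Rightarrow> complex \<Rightarrow> complex" where
  "std_vec i = summand i (pure hilb_C 1 1)"

definition meas_basis ::
    "'a::complex_vector hspace \<Rightarrow> ('a, nat \<Rightarrow> complex \<Rightarrow> complex) cell2 \<Rightarrow> nat \<Rightarrow> 'a" where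
  "meas_basis H M i = inv_into (carr H) (map2 M 0 0) (std_vec i)"

definition complementary :: "nat \<Rightarrow> 'a::complex_vector hspace \<Rightarrow>
    ('a, nat \<Rightarrow> complex \<Rightarrow> complex) cell2 \<Rightarrow> ('a, nat \<Rightarrow> complex \<Rightarrow> complex) cell2 \<Rightarrow> bool" where
  "complementary n H R G \<longleftrightarrow>
     (\<forall>i<n. \<forall>j<n. (cmod (inn H (meas_basis H R i) (meas_basis H G j)))\<^sup>2 = 1 / real (hdim H))"

text \<open>For \<open>K: W\<^sub>L ; W\<^sub>R \<Rightarrow> W\<^sub>L ; W\<^sub>R\<close>, the composite
  \<open>(Compare ; id) \<cdot> (id ; K ; id) \<cdot> (id ; Copy): W\<^sub>R ; W\<^sub>L \<Rightarrow> W\<^sub>R ; W\<^sub>L\<close>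
  with the coherence isomorphisms made explicit.\<close>

definition bend where
  "bend n K =
    (let A = W\<^sub>R n; B = W\<^sub>L n; W = A ;\<^sub>1 B in
       (unit_src W)\<^sup>\<dagger>
       \<cdot> (Compare n ;\<^sub>2 id2 W)
       \<cdot> (assoc W A B)\<^sup>\<dagger>
       \<cdot> (assoc A B A ;\<^sub>2 id2 B)
       \<cdot> ((id2 A ;\<^sub>2 K) ;\<^sub>2 id2 B)
       \<cdot> ((assoc A B A)\<^sup>\<dagger> ;\<^sub>2 id2 B)
       \<cdot> assoc W A B
       \<cdot> (id2 W ;\<^sub>2 Copy n)
       \<cdot> unit_tgt W)"

definition horiz_unitary ::
    "nat \<Rightarrow> (nat \<Rightarrow> complex \<Rightarrow> complex, nat \<Rightarrow> complex \<Rightarrow> complex) cell2 \<Rightarrow> bool" where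
  "horiz_unitary n K \<longleftrightarrow> unitary2 (bend n K)"

definition horiz_unitary_up_to_scalar ::
    "nat \<Rightarrow> (nat \<Rightarrow> complex \<Rightarrow> complex, nat \<Rightarrow> complex \<Rightarrow> complex) cell2 \<Rightarrow> bool" where
  "horiz_unitary_up_to_scalar n K \<longleftrightarrow> (\<exists>c. c \<noteq> 0 \<and> horiz_unitary n (scale2 c K))"

end

theory Submission
  imports Defs
begin

text \<open>
  Write \<open>e\<^sub>i\<close> for the standard basis of \<open>\<complex>\<^sup>n = W\<^sub>L ; W\<^sub>R\<close>, and let \<open>K\<close> be a linear endomorphism of it.
  All entries of \<open>W\<^sub>R ; W\<^sub>L\<close> are one-dimensional, so a 2-cell from \<open>W\<^sub>R ; W\<^sub>L\<close> to itself is an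
  \<open>n \<times> n\<close> matrix of scalars, composed entrywise, and it is unitary iff every scalar has modulus 1
  (\<open>unitary2_entrywise_scalar\<close>). Bending \<open>K\<close> produces the scalar
  \<open>\<langle>e\<^sub>j|K e\<^sub>i\<rangle>\<close> in the entry \<open>(i, j)\<close> (\<open>bend_apply\<close>): Copy feeds the \<open>i\<close>-th basis vector into \<open>K\<close>,
  because it is nonzero only between equal indices, and Compare projects the result to its
  \<open>j\<close>-th coordinate. So the bending turns the matrix elements of one linear map into a matrix of
  linear maps between lines, and horizontal unitarity of \<open>K\<close> says that all its matrix elements have modulus 1.

  For \<open>K = c (G \<cdot> R\<^sup>\<dagger>)\<close> these matrix elements are \<open>c \<langle>b\<^sub>j|a\<^sub>i\<rangle>\<close>, where \<open>a\<close> and \<open>b\<close> are the measured bases,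
  since \<open>R\<^sup>\<dagger> e\<^sub>i = a\<^sub>i\<close> and \<open>G\<close> is an isometry with \<open>G b\<^sub>j = e\<^sub>j\<close> (\<open>horiz_unitary_prep_meas_iff\<close>). Complementarity with
  \<open>dim H = n\<close> makes them unimodular for \<open>c = \<surd>n\<close>. Conversely, if they are unimodular for some \<open>c\<close>, then
  \<open>|\<langle>a\<^sub>i|b\<^sub>j\<rangle>|\<^sup>2\<close> is independent of \<open>i\<close> and \<open>j\<close>, and Parseval's identity for \<open>b\<^sub>j\<close> in the basis \<open>a\<close>
  forces the value \<open>1/n\<close>.

  The matrix elements of the bent 2-cell are computed by following one vector through
  the composite. This rests on an explicit calculus: horizontal composites and associators are evaluated on
  pure tensors sitting in one summand (\<open>hcomp_apply\<close>, \<open>assoc_apply\<close>), and the inverse of a coherence isomorphism is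
  evaluated on its image by undoing the isomorphism, which is legitimate because the adjoint of
  an isometry is a left inverse (\<open>adj_isometric\<close>, \<open>assoc_isometric\<close>).
\<close>

section \<open>Inner products, orthonormal bases and adjoints\<close>

lemma
  assumes "fd_hilbert H"
  shows fd_zero: "0 \<in> carr H"
    and fd_add: "x \<in> carr H \<Longrightarrow> y \<in> carr H \<Longrightarrow> x + y \<in> carr H"
    and fd_scale: "x \<in> carr H \<Longrightarrow> c *\<^sub>C x \<in> carr H"
    and fd_diff: "x \<in> carr H \<Longrightarrow> y \<in> carr H \<Longrightarrow> x - y \<in> carr H"
    and fd_sum: "(\<And>i. i \<in> A \<Longrightarrow> g i \<in> carr H) \<Longrightarrow> (\<Sum>i\<in>A. g i) \<in> carr H"
    and fd_span: "S \<subseteq> carr H \<Longrightarrow> cspan S \<subseteq> carr H"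
proof -
  have S: "csubspace (carr H)" using assms by (simp add: fd_hilbert_def)
  note facts = complex_vector.subspace_0[OF S] complex_vector.subspace_add[OF S]
    complex_vector.subspace_scale[OF S] complex_vector.subspace_diff[OF S]
  show "0 \<in> carr H" "x \<in> carr H \<Longrightarrow> y \<in> carr H \<Longrightarrow> x + y \<in> carr H"
    "x \<in> carr H \<Longrightarrow> c *\<^sub>C x \<in> carr H" "x \<in> carr H \<Longrightarrow> y \<in> carr H \<Longrightarrow> x - y \<in> carr H"
    by (fact facts)+
  show "(\<And>i. i \<in> A \<Longrightarrow> g i \<in> carr H) \<Longrightarrow> (\<Sum>i\<in>A. g i) \<in> carr H"
    by (rule complex_vector.subspace_sum[OF S])
  show "S \<subseteq> carr H \<Longrightarrow> cspan S \<subseteq> carr H" for S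
    by (rule complex_vector.span_minimal[OF _ S])
qed

lemma
  assumes "fd_hilbert H" "x \<in> carr H" "y \<in> carr H"
  shows inn_cnj: "inn H y x = cnj (inn H x y)"
    and inn_add_right: "z \<in> carr H \<Longrightarrow> inn H x (y + z) = inn H x y + inn H x z"
    and inn_scale_right: "inn H x (c *\<^sub>C y) = c * inn H x y"
  using assms unfolding fd_hilbert_def by blast+

lemma inn_add_left:
  assumes "fd_hilbert H" "x \<in> carr H" "y \<in> carr H" "z \<in> carr H"
  shows "inn H (x + y) z = inn H x z + inn H y z"
  using assms by (simp add: inn_cnj[of H z] inn_add_right fd_add)

lemma inn_scale_left:
  assumes "fd_hilbert H" "x \<in> carr H" "y \<in> carr H"
  shows "inn H (c *\<^sub>C x) y = cnj c * inn H x y"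
  using assms by (simp add: inn_cnj[of H y] inn_scale_right fd_scale)

lemma
  assumes "fd_hilbert H" "x \<in> carr H"
  shows inn_zero_right: "inn H x 0 = 0" and inn_zero_left: "inn H 0 x = 0"
  using inn_scale_right[OF assms(1,2) fd_zero, of 0] inn_scale_left[OF assms(1) fd_zero assms(2), of 0]
    assms by auto

lemma inn_diff_right:
  assumes "fd_hilbert H" "x \<in> carr H" "y \<in> carr H" "z \<in> carr H"
  shows "inn H x (y - z) = inn H x y - inn H x z"
  using inn_add_right[OF assms(1,2) fd_diff assms(4), of y z] assms by simp

lemma inn_diff_left:
  assumes "fd_hilbert H" "x \<in> carr H" "y \<in> carr H" "z \<in> carr H"
  shows "inn H (x - y) z = inn H x z - inn H y z"
  using assms by (simp add: inn_cnj[of H z] inn_diff_right fd_diff)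

lemma inn_sum_right:
  assumes "fd_hilbert H" "x \<in> carr H" "\<And>i. i \<in> A \<Longrightarrow> g i \<in> carr H"
  shows "inn H x (\<Sum>i\<in>A. g i) = (\<Sum>i\<in>A. inn H x (g i))"
  using assms(3)
  by (induction A rule: infinite_finite_induct)
    (simp_all add: assms inn_zero_right inn_add_right fd_sum)

lemma inn_sum_left:
  assumes "fd_hilbert H" "x \<in> carr H" "\<And>i. i \<in> A \<Longrightarrow> g i \<in> carr H"
  shows "inn H (\<Sum>i\<in>A. g i) x = (\<Sum>i\<in>A. inn H (g i) x)"
  using assms by (simp add: inn_cnj[of H x] inn_sum_right fd_sum)

lemma inn_pos:
  assumes "fd_hilbert H" "x \<in> carr H" "x \<noteq> 0"
  shows "Im (inn H x x) = 0" "Re (inn H x x) > 0"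
  using assms unfolding fd_hilbert_def by blast+

lemma inn_ext:
  assumes "fd_hilbert H" "x \<in> carr H" "y \<in> carr H" "\<And>z. z \<in> carr H \<Longrightarrow> inn H x z = inn H y z"
  shows "x = y"
  using inn_pos(2)[OF assms(1), of "x - y"] assms by (force simp: inn_diff_left fd_diff)

lemma is_onb_subset:
  assumes "is_onb H E" shows "E \<subseteq> carr H"
  using assms complex_vector.span_superset unfolding is_onb_def by blast

lemma onb_expand:
  assumes H: "fd_hilbert H" and E: "is_onb H E" and x: "x \<in> carr H"
  shows "x = (\<Sum>e\<in>E. inn H e x *\<^sub>C e)"
proof -
  have E': "finite E" "cspan E = carr H" "\<And>e. e \<in> E \<Longrightarrow> e \<in> carr H"
    using E is_onb_subset[OF E] by (auto simp: is_onb_def)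
  obtain u where u: "x = (\<Sum>e\<in>E. u e *\<^sub>C e)"
    using x E'(1,2) complex_vector.span_finite[of E] by auto
  have "inn H d x = u d" if "d \<in> E" for d
  proof -
    have "inn H d x = (\<Sum>e\<in>E. u e * inn H d e)"
      unfolding u using that H E' by (simp add: inn_sum_right fd_scale inn_scale_right)
    also have "\<dots> = (\<Sum>e\<in>E. if d = e then u e else 0)"
      using E that by (intro sum.cong) (auto simp: is_onb_def)
    finally show ?thesis using E'(1) that by simp
  qed
  then show ?thesis using u by simp
qed

lemma onb_parseval:
  assumes H: "fd_hilbert H" and E: "is_onb H E" and x: "x \<in> carr H" and y: "y \<in> carr H"
  shows "inn H x y = (\<Sum>e\<in>E. cnj (inn H e x) * inn H e y)"
proof -
  have E': "\<And>e. e \<in> E \<Longrightarrow> e \<in> carr H" using is_onb_subset[OF E] by auto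
  have "inn H x y = inn H x (\<Sum>e\<in>E. inn H e y *\<^sub>C e)"
    using onb_expand[OF H E y] by simp
  also have "\<dots> = (\<Sum>e\<in>E. inn H e y * inn H x e)"
    using H E' x by (simp add: inn_sum_right fd_scale inn_scale_right)
  finally show ?thesis
    using H E' x by (simp add: inn_cnj[of H _ x] mult.commute)
qed

text \<open>Gram-Schmidt: a new vector is replaced by its normalised component orthogonal to the
  vectors already obtained, or dropped if that component vanishes.\<close>

lemma orthonormal_spanning_set_exists:
  assumes H: "fd_hilbert H" and "finite B" and "B \<subseteq> carr H"
  shows "\<exists>E. finite E \<and> E \<subseteq> carr H \<and> cspan E = cspan B \<and>
    (\<forall>x\<in>E. \<forall>y\<in>E. inn H x y = (if x = y then 1 else 0))"
  using assms(2,3)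
proof (induction B rule: finite_induct)
  case empty
  show ?case by (intro exI[of _ "{}"]) auto
next
  case (insert b B)
  then obtain E where E: "finite E" "E \<subseteq> carr H" "cspan E = cspan B"
    "\<forall>x\<in>E. \<forall>y\<in>E. inn H x y = (if x = y then 1 else 0)" and b: "b \<in> carr H" by auto
  define p where "p = (\<Sum>e\<in>E. inn H e b *\<^sub>C e)"
  define r where "r = b - p"
  have pE: "p \<in> cspan E" unfolding p_def
    by (intro complex_vector.span_sum complex_vector.span_scale complex_vector.span_base)
  have p: "p \<in> carr H" using pE fd_span[OF H E(2)] by blast
  have r: "r \<in> carr H" using p b H by (simp add: r_def fd_diff)
  have orth: "inn H e r = 0" if e: "e \<in> E" for e
  proof -
    have eH: "e \<in> carr H" using e E(2) by auto
    have "inn H e p = (\<Sum>d\<in>E. inn H d b * inn H e d)"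
      unfolding p_def using E(2) H eH
      by (subst inn_sum_right) (auto simp: fd_scale inn_scale_right subset_iff)
    also have "\<dots> = (\<Sum>d\<in>E. if e = d then inn H d b else 0)"
      using E e by (intro sum.cong) auto
    finally have "inn H e p = inn H e b" using E(1) e by simp
    then show ?thesis using H eH b p by (simp add: r_def inn_diff_right)
  qed
  show ?case
  proof (cases "r = 0")
    case True
    then have "b \<in> cspan E" using pE by (simp add: r_def)
    then have "cspan E = cspan (insert b B)"
      using complex_vector.span_redundant[of b B] E(3) by simp
    then show ?thesis using E by (intro exI[of _ E]) auto
  next
    case False
    define t where "t = 1 / sqrt (Re (inn H r r))"
    define s where "s = complex_of_real t"
    have pos: "Re (inn H r r) > 0" and im: "Im (inn H r r) = 0"
      using inn_pos[OF H r False] by auto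
    have rr: "inn H r r = complex_of_real (Re (inn H r r))"
      using im by (simp add: complex_eq_iff)
    have s0: "s \<noteq> 0" using pos by (simp add: s_def t_def)
    define u where "u = s *\<^sub>C r"
    have u: "u \<in> carr H" using H r by (simp add: u_def fd_scale)
    have "inn H u u = cnj s * (s * inn H r r)"
      using H r by (simp add: u_def inn_scale_left inn_scale_right fd_scale)
    also have "\<dots> = complex_of_real (t * (t * Re (inn H r r)))"
      by (subst rr) (simp add: s_def)
    also have "t * (t * Re (inn H r r)) = 1" using pos by (simp add: t_def)
    finally have uu: "inn H u u = 1" by simp
    have eu: "inn H e u = 0" "inn H u e = 0" if "e \<in> E" for e
      using orth[OF that] that E(2) H r u inn_cnj[OF H, of e u]
      by (auto simp: u_def inn_scale_right subset_iff)
    have rb: "b = inverse s *\<^sub>C u + p"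
      using s0 by (simp add: u_def scaleC_scaleC scaleC_one r_def)
    have "cspan (insert u E) = cspan (insert b B)"
    proof -
      have "b \<in> cspan (insert u E)"
        unfolding rb using pE complex_vector.span_mono[of E "insert u E"]
        by (intro complex_vector.span_add complex_vector.span_scale) (auto intro: complex_vector.span_base)
      moreover have "B \<subseteq> cspan (insert u E)"
        using complex_vector.span_superset[of B] E(3) complex_vector.span_mono[of E "insert u E"] by auto
      moreover have sub: "cspan E \<subseteq> cspan (insert b B)"
        unfolding E(3) by (rule complex_vector.span_mono) auto
      moreover have "u \<in> cspan (insert b B)"
        unfolding u_def r_def using sub pE
        by (intro complex_vector.span_scale complex_vector.span_diff) (auto intro: complex_vector.span_base)
      moreover have "E \<subseteq> cspan (insert b B)"
        using sub complex_vector.span_superset[of E] by auto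
      ultimately show ?thesis unfolding complex_vector.span_eq by auto
    qed
    then show ?thesis using E u uu eu by (intro exI[of _ "insert u E"]) auto
  qed
qed

lemma onb_exists:
  assumes "fd_hilbert H" shows "\<exists>E. is_onb H E"
proof -
  obtain B where B: "finite B" "cspan B = carr H" using assms unfolding fd_hilbert_def by auto
  then have "B \<subseteq> carr H" using complex_vector.span_superset by blast
  from orthonormal_spanning_set_exists[OF assms B(1) this] show ?thesis
    using B(2) unfolding is_onb_def by blast
qed

lemma onb_hdim:
  assumes H: "fd_hilbert H" and E: "is_onb H E"
  shows "hdim H = card E"
proof -
  have E': "finite E" "cspan E = carr H" "\<And>e. e \<in> E \<Longrightarrow> e \<in> carr H"
    using E is_onb_subset[OF E] by (auto simp: is_onb_def)
  have "complex_vector.independent E"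
  proof (rule complex_vector.independent_if_scalars_zero[OF E'(1)])
    fix f d assume f: "(\<Sum>e\<in>E. f e *\<^sub>C e) = 0" and d: "d \<in> E"
    have "0 = inn H d (\<Sum>e\<in>E. f e *\<^sub>C e)" using f d H E' by (simp add: inn_zero_right)
    also have "\<dots> = (\<Sum>e\<in>E. f e * inn H d e)"
      using d H E' by (simp add: inn_sum_right fd_scale inn_scale_right)
    also have "\<dots> = (\<Sum>e\<in>E. if d = e then f e else 0)"
      using E d by (intro sum.cong) (auto simp: is_onb_def)
    finally show "f d = 0" using E'(1) d by simp
  qed
  then show ?thesis
    unfolding hdim_def using complex_vector.dim_span_eq_card_independent[of E] E'(2) 
      complex_vector.dim_span by metis
qed

lemma
  assumes "f \<in> linear_maps H K"
  shows linear_maps_carr: "x \<in> carr H \<Longrightarrow> f x \<in> carr K"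
    and linear_maps_add: "x \<in> carr H \<Longrightarrow> y \<in> carr H \<Longrightarrow> f (x + y) = f x + f y"
    and linear_maps_scale: "x \<in> carr H \<Longrightarrow> f (c *\<^sub>C x) = c *\<^sub>C f x"
    and linear_maps_outside: "x \<notin> carr H \<Longrightarrow> f x = 0"
  using assms unfolding linear_maps_def by auto

lemma linear_maps_zero: "f \<in> linear_maps H K \<Longrightarrow> f 0 = 0"
  using linear_maps_scale[of f H K 0 0] linear_maps_outside[of f H K 0]
  by (cases "0 \<in> carr H") auto

lemma linear_maps_sum:
  assumes "fd_hilbert H" "f \<in> linear_maps H K" "\<And>i. i \<in> A \<Longrightarrow> g i \<in> carr H"
  shows "f (\<Sum>i\<in>A. g i) = (\<Sum>i\<in>A. f (g i))"
  using assms(3)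
  by (induction A rule: infinite_finite_induct)
    (simp_all add: linear_maps_zero[OF assms(2)] linear_maps_add[OF assms(2)] fd_sum[OF assms(1)])

lemma linear_maps_comp:
  assumes "f \<in> linear_maps H K" "g \<in> linear_maps K L"
  shows "g \<circ> f \<in> linear_maps H L"
  using assms linear_maps_zero[OF assms(2)] unfolding linear_maps_def by auto

lemma restr_linear_maps:
  assumes "fd_hilbert H" "\<And>x. x \<in> carr H \<Longrightarrow> f x \<in> carr K"
    "\<And>x y. x \<in> carr H \<Longrightarrow> y \<in> carr H \<Longrightarrow> f (x + y) = f x + f y"
    "\<And>x c. x \<in> carr H \<Longrightarrow> f (c *\<^sub>C x) = c *\<^sub>C f x"
  shows "restr H f \<in> linear_maps H K"
  using assms by (auto simp: linear_maps_def restr_def fd_add fd_scale)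

text \<open>The definite description in the adjoint is resolved by the vector
  \<open>\<Sum>\<^sub>e \<langle>f e|y\<rangle> e\<close>, with \<open>e\<close> running through an orthonormal basis.\<close>

lemma
  assumes H: "fd_hilbert H" and K: "fd_hilbert K" and f: "f \<in> linear_maps H K" and y: "y \<in> carr K"
  shows adj_carr: "adj H K f y \<in> carr H"
    and adj_inn: "x \<in> carr H \<Longrightarrow> inn H (adj H K f y) x = inn K y (f x)"
proof -
  obtain E where E: "is_onb H E" using onb_exists[OF H] by auto
  have E': "\<And>e. e \<in> E \<Longrightarrow> e \<in> carr H" using is_onb_subset[OF E] by auto
  define x0 where "x0 = (\<Sum>e\<in>E. inn K (f e) y *\<^sub>C e)"
  have x0: "x0 \<in> carr H" unfolding x0_def using E' H by (simp add: fd_sum fd_scale)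
  have char: "inn H x0 z = inn K y (f z)" if z: "z \<in> carr H" for z
  proof -
    have "inn K y (f z) = inn K y (f (\<Sum>e\<in>E. inn H e z *\<^sub>C e))"
      using onb_expand[OF H E z] by simp
    also have "f (\<Sum>e\<in>E. inn H e z *\<^sub>C e) = (\<Sum>e\<in>E. inn H e z *\<^sub>C f e)"
      using E' H by (simp add: linear_maps_sum[OF H f] linear_maps_scale[OF f] fd_scale)
    also have "inn K y \<dots> = (\<Sum>e\<in>E. inn H e z * inn K y (f e))"
      using E' H K y by (simp add: inn_sum_right inn_scale_right fd_scale linear_maps_carr[OF f])
    also have "\<dots> = inn H x0 z" unfolding x0_def
      using E' H K y z by (simp add: inn_sum_left inn_scale_left fd_scale
          inn_cnj[OF K y] linear_maps_carr[OF f] mult.commute)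
    finally show ?thesis by simp
  qed
  have "(THE x. x \<in> carr H \<and> (\<forall>z\<in>carr H. inn H x z = inn K y (f z))) = x0"
    using x0 char by (intro the_equality) (auto intro: inn_ext[OF H _ x0])
  then have "adj H K f y = x0" using y by (simp add: adj_def restr_def)
  then show "adj H K f y \<in> carr H" "x \<in> carr H \<Longrightarrow> inn H (adj H K f y) x = inn K y (f x)"
    using x0 char by auto
qed

lemma adj_eqI:
  assumes "fd_hilbert H" "fd_hilbert K" "f \<in> linear_maps H K" "y \<in> carr K" "x \<in> carr H"
    "\<And>z. z \<in> carr H \<Longrightarrow> inn H x z = inn K y (f z)"
  shows "adj H K f y = x"
  using assms by (intro inn_ext[of H]) (auto simp: adj_carr adj_inn)

lemma adj_linear_maps:
  assumes "fd_hilbert H" "fd_hilbert K" "f \<in> linear_maps H K"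
  shows "adj H K f \<in> linear_maps K H"
proof -
  have "adj H K f (x + y) = adj H K f x + adj H K f y" if "x \<in> carr K" "y \<in> carr K" for x y
    using that assms
    by (intro adj_eqI) (auto simp: fd_add adj_carr adj_inn inn_add_left linear_maps_carr[of f H K])
  moreover have "adj H K f (c *\<^sub>C x) = c *\<^sub>C adj H K f x" if "x \<in> carr K" for x c
    using that assms
    by (intro adj_eqI) (auto simp: fd_scale adj_carr adj_inn inn_scale_left linear_maps_carr[of f H K])
  moreover have "adj H K f x = 0" if "x \<notin> carr K" for x
    using that by (simp add: adj_def restr_def)
  ultimately show ?thesis using adj_carr[OF assms] by (simp add: linear_maps_def)
qed

definition isometric :: "'a::complex_vector hspace \<Rightarrow> 'b::complex_vector hspace \<Rightarrow> ('a \<Rightarrow> 'b) \<Rightarrow> bool" where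
  "isometric H K f \<longleftrightarrow> f \<in> linear_maps H K \<and> (\<forall>x\<in>carr H. \<forall>y\<in>carr H. inn K (f x) (f y) = inn H x y)"

text \<open>An isometry need not be surjective for its adjoint to undo it; this is why the inverses of
  the coherence isomorphisms can be computed on given vectors from isometry alone.\<close>

lemma adj_isometric:
  assumes "fd_hilbert H" "fd_hilbert K" "isometric H K f" "x \<in> carr H"
  shows "adj H K f (f x) = x"
  using assms by (intro adj_eqI) (auto simp: isometric_def linear_maps_carr)

text \<open>Maps between Hilbert spaces are linear only on the carrier, so the induction steps keep the
  information that the vectors involved lie in the span.\<close>

lemma cspan_induct_on [consumes 1, case_names base zero add scale]:
  assumes "x \<in> cspan S" "\<And>x. x \<in> S \<Longrightarrow> P x" "P 0"
    "\<And>x y. x \<in> cspan S \<Longrightarrow> y \<in> cspan S \<Longrightarrow> P x \<Longrightarrow> P y \<Longrightarrow> P (x + y)"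
    "\<And>c x. x \<in> cspan S \<Longrightarrow> P x \<Longrightarrow> P (c *\<^sub>C x)"
  shows "P x"
proof -
  have "csubspace {x. x \<in> cspan S \<and> P x}"
    using assms(3-5) by (intro complex_vector.subspaceI)
      (auto intro: complex_vector.span_zero complex_vector.span_add complex_vector.span_scale)
  then have "cspan S \<subseteq> {x. x \<in> cspan S \<and> P x}"
    using assms(2) by (intro complex_vector.span_minimal) (auto intro: complex_vector.span_base)
  then show ?thesis using assms(1) by blast
qed

lemma isometricI_span:
  assumes H: "fd_hilbert H" and K: "fd_hilbert K" and f: "f \<in> linear_maps H K"
    and S: "cspan S = carr H"
    and iso: "\<And>x y. x \<in> S \<Longrightarrow> y \<in> S \<Longrightarrow> inn K (f x) (f y) = inn H x y"
  shows "isometric H K f"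
proof -
  have SH: "\<And>x. x \<in> S \<Longrightarrow> x \<in> carr H" using S complex_vector.span_superset[of S] by auto
  have fc: "\<And>x. x \<in> carr H \<Longrightarrow> f x \<in> carr K" by (rule linear_maps_carr[OF f])
  note simps = H K fc inn_add_left inn_add_right inn_scale_left inn_scale_right inn_zero_left
    inn_zero_right linear_maps_add[OF f] linear_maps_scale[OF f] linear_maps_zero[OF f] fd_zero
  have 1: "inn K (f x) (f y) = inn H x y" if x: "x \<in> S" and y: "y \<in> cspan S" for x y
    using y by (induction rule: cspan_induct_on) (simp_all add: simps S SH x iso)
  have "inn K (f x) (f y) = inn H x y" if "x \<in> cspan S" "y \<in> cspan S" for x y
    using that by (induction rule: cspan_induct_on) (simp_all add: simps S SH 1)
  then show ?thesis using f S by (simp add: isometric_def)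
qed

section \<open>Tensor products and direct sums\<close>

lemma scaleC_zero_right [simp]: "c *\<^sub>C (0::'a::complex_vector) = 0"
  by (rule complex_vector.scale_zero_right)

lemma scaleC_zero_left [simp]: "0 *\<^sub>C (x::'a::complex_vector) = 0"
  by (rule complex_vector.scale_zero_left)

lemma scaleC_fun_apply [simp]: "(c *\<^sub>C f) x = c *\<^sub>C f x"
  by (simp add: scaleC_fun_def)

lemma sum_fun_apply: "(\<Sum>i\<in>A. f i) x = (\<Sum>i\<in>A. f i x)"
  by (induction A rule: infinite_finite_induct) simp_all

lemma carr_tensor: "carr (tensor H K) = antilinear_maps H K"
  by (simp add: tensor_def)

lemma
  assumes "T \<in> carr (tensor H K)"
  shows antilinear_carr: "x \<in> carr H \<Longrightarrow> T x \<in> carr K"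
    and antilinear_add: "x \<in> carr H \<Longrightarrow> y \<in> carr H \<Longrightarrow> T (x + y) = T x + T y"
    and antilinear_scale: "x \<in> carr H \<Longrightarrow> T (c *\<^sub>C x) = cnj c *\<^sub>C T x"
    and antilinear_outside: "x \<notin> carr H \<Longrightarrow> T x = 0"
  using assms unfolding carr_tensor antilinear_maps_def by auto

lemma antilinear_sum:
  assumes "fd_hilbert H" "T \<in> carr (tensor H K)" "\<And>i. i \<in> A \<Longrightarrow> g i \<in> carr H"
  shows "T (\<Sum>i\<in>A. g i) = (\<Sum>i\<in>A. T (g i))"
proof -
  have "T 0 = 0" using antilinear_scale[OF assms(2) fd_zero[OF assms(1)], of 0] by simp
  then show ?thesis using assms(3)
    by (induction A rule: infinite_finite_induct)
      (simp_all add: antilinear_add[OF assms(2)] fd_sum[OF assms(1)])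
qed

lemma csubspace_tensor:
  assumes "fd_hilbert K" shows "csubspace (carr (tensor H K))"
  using assms unfolding carr_tensor antilinear_maps_def
  by (intro complex_vector.subspaceI)
    (auto simp: fd_zero fd_add fd_scale scaleC_add_right scaleC_scaleC mult.commute)

lemma inn_tensor:
  assumes "fd_hilbert H"
  shows "\<exists>E. is_onb H E \<and> (\<forall>S T. inn (tensor H K) S T = (\<Sum>e\<in>E. inn K (S e) (T e)))"
  using someI_ex[OF onb_exists[OF assms]] by (auto simp: tensor_def)

lemma pure_apply: "x \<in> carr H \<Longrightarrow> pure H u v x = inn H x u *\<^sub>C v"
  by (simp add: pure_def restr_def)

lemma pure_carr:
  assumes "fd_hilbert H" "fd_hilbert K" "x \<in> carr H" "y \<in> carr K"
  shows "pure H x y \<in> carr (tensor H K)"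
  using assms unfolding carr_tensor antilinear_maps_def pure_def restr_def
  by (auto simp: fd_add fd_scale inn_add_left inn_scale_left scaleC_add_left scaleC_scaleC)

lemma pure_add_left: "fd_hilbert H \<Longrightarrow> x \<in> carr H \<Longrightarrow> x' \<in> carr H \<Longrightarrow>
    pure H (x + x') y = pure H x y + pure H x' y"
  by (rule ext) (simp add: pure_def restr_def inn_add_right scaleC_add_left)

lemma pure_scale_left: "fd_hilbert H \<Longrightarrow> x \<in> carr H \<Longrightarrow> pure H (c *\<^sub>C x) y = c *\<^sub>C pure H x y"
  by (rule ext) (simp add: pure_def restr_def inn_scale_right scaleC_scaleC)

lemma pure_add_right: "pure H x (y + y') = pure H x y + pure H x y'"
  by (rule ext) (simp add: pure_def restr_def scaleC_add_right)

lemma pure_scale_right: "pure H x (c *\<^sub>C y) = c *\<^sub>C pure H x y"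
  by (rule ext) (simp add: pure_def restr_def scaleC_scaleC mult.commute)

lemma pure_zero_left: "fd_hilbert H \<Longrightarrow> pure H 0 y = 0"
  by (rule ext) (simp add: pure_def restr_def inn_zero_right)

lemma pure_zero_right [simp]: "pure H x 0 = 0"
  by (rule ext) (simp add: pure_def restr_def)

text \<open>This identification of an antilinear map with a sum of pure tensors is what makes the tensor
  product of finite-dimensional spaces finite-dimensional.\<close>

lemma tensor_expand:
  assumes H: "fd_hilbert H" and E: "is_onb H E" and T: "T \<in> carr (tensor H K)"
  shows "T = (\<Sum>e\<in>E. pure H e (T e))"
proof
  fix z
  have E': "\<And>e. e \<in> E \<Longrightarrow> e \<in> carr H" using is_onb_subset[OF E] by auto
  show "T z = (\<Sum>e\<in>E. pure H e (T e)) z"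
  proof (cases "z \<in> carr H")
    case True
    have "T z = T (\<Sum>e\<in>E. inn H e z *\<^sub>C e)" using onb_expand[OF H E True] by simp
    also have "\<dots> = (\<Sum>e\<in>E. inn H z e *\<^sub>C T e)"
      using E' H T True
      by (simp add: antilinear_sum[OF H T] fd_scale antilinear_scale[OF T] inn_cnj[of H _ z, symmetric])
    finally show ?thesis using True by (simp add: sum_fun_apply pure_apply)
  next
    case False
    then show ?thesis using T by (simp add: sum_fun_apply pure_def restr_def antilinear_outside)
  qed
qed

lemma cspan_pure:
  assumes H: "fd_hilbert H" and K: "fd_hilbert K" and S: "cspan S = carr H" and S': "cspan S' = carr K"
  shows "cspan {pure H x y |x y. x \<in> S \<and> y \<in> S'} = carr (tensor H K)" (is "cspan ?P = _")
proof
  have SH: "S \<subseteq> carr H" "S' \<subseteq> carr K" using S S' complex_vector.span_superset by auto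
  show "cspan ?P \<subseteq> carr (tensor H K)"
    using SH by (intro complex_vector.span_minimal csubspace_tensor[OF K]) (auto intro!: pure_carr H K)
  have 1: "pure H x y \<in> cspan ?P" if x: "x \<in> S" and y: "y \<in> cspan S'" for x y
    using y
  proof (induction rule: cspan_induct_on)
    case (base y)
    then show ?case using x by (intro complex_vector.span_base) auto
  qed (simp_all only: pure_add_right pure_scale_right pure_zero_right complex_vector.span_add
        complex_vector.span_scale complex_vector.span_zero)
  have 2: "pure H x y \<in> cspan ?P" if "x \<in> cspan S" "y \<in> cspan S'" for x y
    using that by (induction rule: cspan_induct_on)
      (simp_all only: S 1 pure_zero_left[OF H] pure_add_left[OF H] pure_scale_left[OF H]
        complex_vector.span_add complex_vector.span_scale complex_vector.span_zero)
  show "carr (tensor H K) \<subseteq> cspan ?P"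
  proof
    fix T assume T: "T \<in> carr (tensor H K)"
    obtain E where E: "is_onb H E" using onb_exists[OF H] by auto
    have "\<And>e. e \<in> E \<Longrightarrow> e \<in> carr H" using is_onb_subset[OF E] by auto
    then have "(\<Sum>e\<in>E. pure H e (T e)) \<in> cspan ?P"
      using antilinear_carr[OF T] by (intro complex_vector.span_sum 2) (auto simp: S S')
    then show "T \<in> cspan ?P" using tensor_expand[OF H E T] by simp
  qed
qed

text \<open>Positivity holds because an antilinear map that vanishes on an orthonormal basis is zero.\<close>

lemma fd_tensor:
  assumes H: "fd_hilbert H" and K: "fd_hilbert K"
  shows "fd_hilbert (tensor H K)"
proof -
  obtain E where E: "is_onb H E"
    and inn: "\<And>S T. inn (tensor H K) S T = (\<Sum>e\<in>E. inn K (S e) (T e))"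
    using inn_tensor[OF H, of K] by auto
  have E': "finite E" "\<And>e. e \<in> E \<Longrightarrow> e \<in> carr H" using E is_onb_subset[OF E] by (auto simp: is_onb_def)
  note ac = antilinear_carr[OF _ E'(2)]
  have "\<exists>B. finite B \<and> cspan B = carr (tensor H K)"
  proof -
    obtain B C where B: "finite B" "cspan B = carr H" and C: "finite C" "cspan C = carr K"
      using H K unfolding fd_hilbert_def by auto
    have "finite {pure H x y |x y. x \<in> B \<and> y \<in> C}"
      using finite_image_set2[of "\<lambda>x. x \<in> B" "\<lambda>y. y \<in> C" "pure H"] B C by simp
    then show ?thesis using cspan_pure[OF H K B(2) C(2)] by blast
  qed
  moreover have "inn (tensor H K) T S = cnj (inn (tensor H K) S T)"
    if "S \<in> carr (tensor H K)" "T \<in> carr (tensor H K)" for S T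
    unfolding inn cnj_sum using that by (intro sum.cong) (auto intro!: inn_cnj[OF K] ac)
  moreover have "inn (tensor H K) S (T + U) = inn (tensor H K) S T + inn (tensor H K) S U"
    if "S \<in> carr (tensor H K)" "T \<in> carr (tensor H K)" "U \<in> carr (tensor H K)" for S T U
    using that by (simp add: inn sum.distrib[symmetric] inn_add_right[OF K] ac cong: sum.cong)
  moreover have "inn (tensor H K) S (c *\<^sub>C T) = c * inn (tensor H K) S T"
    if "S \<in> carr (tensor H K)" "T \<in> carr (tensor H K)" for S T c
    using that by (simp add: inn sum_distrib_left inn_scale_right[OF K] ac cong: sum.cong)
  moreover have "Im (inn (tensor H K) T T) = 0 \<and> Re (inn (tensor H K) T T) > 0"
    if T: "T \<in> carr (tensor H K)" and T0: "T \<noteq> 0" for T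
  proof -
    have im: "Im (inn K x x) = 0" and re: "Re (inn K x x) \<ge> 0" if "x \<in> carr K" for x
      using that inn_pos[OF K that] by (cases "x = 0"; force simp: inn_zero_right[OF K])+
    obtain e where e: "e \<in> E" "T e \<noteq> 0"
      using T0 tensor_expand[OF H E T] by (metis (no_types, lifting) pure_zero_right sum.neutral)
    have "(\<Sum>e\<in>E. Re (inn K (T e) (T e))) > 0"
      using e E'(1) T by (intro sum_pos2[of E e]) (auto intro!: re inn_pos(2)[OF K] ac)
    moreover have "(\<Sum>e\<in>E. Im (inn K (T e) (T e))) = 0"
      using T by (intro sum.neutral) (auto intro!: im ac)
    ultimately show ?thesis by (simp add: inn)
  qed
  ultimately show ?thesis
    unfolding fd_hilbert_def using csubspace_tensor[OF K, of H] by blast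
qed

text \<open>Parseval's identity makes the right-hand side independent of the orthonormal basis chosen
  in the definition of the tensor product.\<close>

lemma inn_pure:
  assumes H: "fd_hilbert H" and K: "fd_hilbert K"
    and "x \<in> carr H" "y \<in> carr K" "x' \<in> carr H" "y' \<in> carr K"
  shows "inn (tensor H K) (pure H x y) (pure H x' y') = inn H x x' * inn K y y'"
proof -
  obtain E where E: "is_onb H E"
    and inn: "\<And>S T. inn (tensor H K) S T = (\<Sum>e\<in>E. inn K (S e) (T e))"
    using inn_tensor[OF H, of K] by auto
  have E': "\<And>e. e \<in> E \<Longrightarrow> e \<in> carr H" using is_onb_subset[OF E] by auto
  show ?thesis
    using assms E' by (simp add: inn pure_apply inn_scale_left inn_scale_right fd_scale
        onb_parseval[OF H E, of x x'] sum_distrib_left mult_ac cong: sum.cong)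
qed

lemma tensor_map_carr:
  assumes "fd_hilbert H" "fd_hilbert H'" "f \<in> linear_maps H H'"
    and "g \<in> linear_maps K K'" "T \<in> carr (tensor H K)"
  shows "tensor_map H H' f g T \<in> carr (tensor H' K')"
proof -
  have f: "adj H H' f \<in> linear_maps H' H" using assms by (intro adj_linear_maps)
  show ?thesis
    using assms unfolding carr_tensor[of H'] antilinear_maps_def tensor_map_def restr_def
    by (auto simp: fd_add fd_scale linear_maps_carr[OF f] linear_maps_add[OF f] linear_maps_scale[OF f]
        linear_maps_carr[of g] linear_maps_add[of g] linear_maps_scale[of g]
        antilinear_carr[OF assms(5)] antilinear_add[OF assms(5)] antilinear_scale[OF assms(5)])
qed

lemma
  assumes "fd_hilbert H" "fd_hilbert H'" "f \<in> linear_maps H H'"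
    and "g \<in> linear_maps K K'" "T \<in> carr (tensor H K)"
  shows tensor_map_add: "U \<in> carr (tensor H K) \<Longrightarrow>
      tensor_map H H' f g (T + U) = tensor_map H H' f g T + tensor_map H H' f g U"
    and tensor_map_scale: "tensor_map H H' f g (c *\<^sub>C T) = c *\<^sub>C tensor_map H H' f g T"
  using assms unfolding tensor_map_def restr_def
  by (auto simp: fun_eq_iff adj_carr linear_maps_add[of g] linear_maps_scale[of g] antilinear_carr)

lemma tensor_map_zero: "g \<in> linear_maps K K' \<Longrightarrow> tensor_map H H' f g 0 = 0"
  by (auto simp: fun_eq_iff tensor_map_def restr_def linear_maps_zero)

lemma tensor_map_pure:
  assumes "fd_hilbert H" "fd_hilbert H'" "f \<in> linear_maps H H'"
    and "g \<in> linear_maps K K'" "x \<in> carr H" "y \<in> carr K"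
  shows "tensor_map H H' f g (pure H x y) = pure H' (f x) (g y)"
  using assms by (auto simp: fun_eq_iff tensor_map_def pure_def restr_def adj_carr adj_inn
      linear_maps_scale)

lemma summand_apply: "summand k x k' = (if k' = k then x else 0)"
  by (simp add: summand_def)

lemma summand_add: "summand k (x + y) = summand k x + summand k (y::'a::complex_vector)"
  by (rule ext) (simp add: summand_def)

lemma summand_scale: "summand k (c *\<^sub>C x) = c *\<^sub>C summand k x"
  by (rule ext) (simp add: summand_def)

lemma summand_zero [simp]: "summand k 0 = 0"
  by (rule ext) (simp add: summand_def)

lemma carr_dsum: "v \<in> carr (dsum m V) \<longleftrightarrow> (\<forall>k<m. v k \<in> carr (V k)) \<and> (\<forall>k\<ge>m. v k = 0)"
  by (simp add: dsum_def)

lemma inn_dsum: "inn (dsum m V) v w = (\<Sum>k<m. inn (V k) (v k) (w k))"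
  by (simp add: dsum_def)

lemma csubspace_dsum:
  assumes "\<And>k. k < m \<Longrightarrow> fd_hilbert (V k)" shows "csubspace (carr (dsum m V))"
  using assms by (intro complex_vector.subspaceI) (auto simp: carr_dsum fd_zero fd_add fd_scale)

lemma summand_carr:
  assumes "\<And>k. k < m \<Longrightarrow> fd_hilbert (V k)" "k < m" "x \<in> carr (V k)"
  shows "summand k x \<in> carr (dsum m V)"
  using assms by (auto simp: carr_dsum summand_def fd_zero)

lemma inn_summand:
  assumes V: "\<And>k. k < m \<Longrightarrow> fd_hilbert (V k)" and "k < m" "x \<in> carr (V k)" "l < m" "y \<in> carr (V l)"
  shows "inn (dsum m V) (summand k x) (summand l y) = (if k = l then inn (V k) x y else 0)"
proof -
  have "inn (V i) (summand k x i) (summand l y i) = (if i = k then if k = l then inn (V k) x y else 0 else 0)"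
    if "i < m" for i
    using that assms fd_zero[OF V[OF that]]
    by (auto simp: summand_def inn_zero_left[OF V] inn_zero_right[OF V])
  then have "inn (dsum m V) (summand k x) (summand l y) =
      (\<Sum>i<m. if i = k then if k = l then inn (V k) x y else 0 else 0)"
    unfolding inn_dsum by (intro sum.cong) auto
  then show ?thesis using \<open>k < m\<close> by simp
qed

lemma dsum_expand:
  assumes "v \<in> carr (dsum m V)" shows "v = (\<Sum>k<m. summand k (v k))"
  using assms by (auto simp: fun_eq_iff sum_fun_apply summand_apply carr_dsum not_less)

lemma cspan_summand:
  assumes V: "\<And>k. k < m \<Longrightarrow> fd_hilbert (V k)" and S: "\<And>k. k < m \<Longrightarrow> cspan (S k) = carr (V k)"
  shows "cspan {summand k x |k x. k < m \<and> x \<in> S k} = carr (dsum m V)" (is "cspan ?P = _")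
proof
  have SV: "S k \<subseteq> carr (V k)" if "k < m" for k using S[OF that] complex_vector.span_superset by auto
  show "cspan ?P \<subseteq> carr (dsum m V)"
    using SV V by (intro complex_vector.span_minimal csubspace_dsum) (auto intro!: summand_carr)
  have 1: "summand k x \<in> cspan ?P" if k: "k < m" and x: "x \<in> cspan (S k)" for k x
    using x
  proof (induction rule: cspan_induct_on)
    case (base x)
    then show ?case using k by (intro complex_vector.span_base) auto
  qed (simp_all only: summand_add summand_scale summand_zero complex_vector.span_add
        complex_vector.span_scale complex_vector.span_zero)
  show "carr (dsum m V) \<subseteq> cspan ?P"
  proof
    fix v assume v: "v \<in> carr (dsum m V)"
    then have "(\<Sum>k<m. summand k (v k)) \<in> cspan ?P"
      by (intro complex_vector.span_sum 1) (auto simp: S carr_dsum)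
    then show "v \<in> cspan ?P" using dsum_expand[OF v] by simp
  qed
qed

lemma fd_dsum:
  assumes V: "\<And>k. k < m \<Longrightarrow> fd_hilbert (V k)" shows "fd_hilbert (dsum m V)"
proof -
  have dc: "v k \<in> carr (V k)" if "v \<in> carr (dsum m V)" "k < m" for v k
    using that by (simp add: carr_dsum)
  have "\<exists>B. finite B \<and> cspan B = carr (dsum m V)"
  proof -
    have "\<exists>B. k < m \<longrightarrow> finite B \<and> cspan B = carr (V k)" for k
      using onb_exists[OF V, of k] unfolding is_onb_def by blast
    then obtain B where B: "\<And>k. k < m \<Longrightarrow> finite (B k)" "\<And>k. k < m \<Longrightarrow> cspan (B k) = carr (V k)"
      by metis
    have "{summand k x |k x. k < m \<and> x \<in> B k} = (\<Union>k<m. summand k ` B k)" by auto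
    then have "finite {summand k x |k x. k < m \<and> x \<in> B k}" using B(1) by auto
    then show ?thesis using cspan_summand[of m V B, OF V B(2)] by blast
  qed
  moreover have "inn (dsum m V) w v = cnj (inn (dsum m V) v w)"
    if "v \<in> carr (dsum m V)" "w \<in> carr (dsum m V)" for v w
    unfolding inn_dsum cnj_sum using that
    by (intro sum.cong refl) (metis dc V inn_cnj lessThan_iff)
  moreover have "inn (dsum m V) u (v + w) = inn (dsum m V) u v + inn (dsum m V) u w"
    if "u \<in> carr (dsum m V)" "v \<in> carr (dsum m V)" "w \<in> carr (dsum m V)" for u v w
    unfolding inn_dsum sum.distrib[symmetric] using dc[OF that(1)] dc[OF that(2)] dc[OF that(3)] V
    by (intro sum.cong refl) (simp add: inn_add_right)
  moreover have "inn (dsum m V) v (c *\<^sub>C w) = c * inn (dsum m V) v w"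
    if "v \<in> carr (dsum m V)" "w \<in> carr (dsum m V)" for v w c
    unfolding inn_dsum sum_distrib_left using dc[OF that(1)] dc[OF that(2)] V
    by (intro sum.cong refl) (simp add: inn_scale_right)
  moreover have "Im (inn (dsum m V) v v) = 0 \<and> Re (inn (dsum m V) v v) > 0"
    if v: "v \<in> carr (dsum m V)" and v0: "v \<noteq> 0" for v
  proof -
    have im: "Im (inn (V k) x x) = 0" and re: "Re (inn (V k) x x) \<ge> 0"
      if "k < m" "x \<in> carr (V k)" for k x
      using that inn_pos[OF V[OF that(1)] that(2)]
      by (cases "x = 0"; force simp: inn_zero_right[OF V])+
    obtain k where k: "k < m" "v k \<noteq> 0"
      using v0 v by (auto simp: fun_eq_iff carr_dsum) (metis not_le)
    have "(\<Sum>k<m. Re (inn (V k) (v k) (v k))) > 0"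
      using k v dc[OF v] re inn_pos(2)[OF V[OF k(1)]] by (intro sum_pos2[of _ k]) auto
    moreover have "(\<Sum>k<m. Im (inn (V k) (v k) (v k))) = 0"
      using v dc[OF v] im by (intro sum.neutral) auto
    ultimately show ?thesis by (simp add: inn_dsum)
  qed
  ultimately show ?thesis
    unfolding fd_hilbert_def using csubspace_dsum[of m V, OF V] by blast
qed

lemma fd_hilb_C: "fd_hilbert hilb_C"
proof -
  have "cspan {1} = (UNIV :: complex set)"
    unfolding complex_vector.span_singleton by (auto simp: scaleC_complex_def)
  then have "\<exists>B. finite B \<and> cspan B = (UNIV :: complex set)" by (intro exI[of _ "{1}"]) simp
  then show ?thesis unfolding fd_hilbert_def
    by (auto simp: hilb_C_def scaleC_complex_def algebra_simps complex_eq_iff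
        intro: complex_vector.subspace_UNIV)
      (metis complex_eq_iff not_sum_power2_lt_zero power2_eq_square sum_power2_gt_zero_iff zero_complex.sel)+
qed

lemma fd_hilb_zero: "fd_hilbert hilb_zero"
  unfolding fd_hilbert_def
  by (auto simp: hilb_zero_def complex_vector.subspace_single_0 intro!: exI[of _ "{}"])

section \<open>Calculus of 1-cells and 2-cells\<close>

lemma fd_cspan_carr: "fd_hilbert H \<Longrightarrow> cspan (carr H) = carr H"
  unfolding fd_hilbert_def by (simp add: complex_vector.span_eq_iff)

lemma src_comp1 [simp]: "src (F ;\<^sub>1 G) = src F"
  and tgt_comp1 [simp]: "tgt (F ;\<^sub>1 G) = tgt G"
  by (simp_all add: comp1_def)

lemma ent_comp1: "ent (F ;\<^sub>1 G) i k = dsum (tgt F) (\<lambda>j. tensor (ent G i j) (ent F j k))"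
  by (simp add: comp1_def)

lemma fd_ent: "is_cell1 F \<Longrightarrow> i < tgt F \<Longrightarrow> j < src F \<Longrightarrow> fd_hilbert (ent F i j)"
  by (simp add: is_cell1_def)

lemma is_cell1_comp1:
  assumes "is_cell1 F" "is_cell1 G" "tgt F = src G"
  shows "is_cell1 (F ;\<^sub>1 G)"
  using assms unfolding is_cell1_def by (auto simp: ent_comp1 intro!: fd_dsum fd_tensor)

context
  fixes F :: "'a::complex_vector cell1" and G :: "'b::complex_vector cell1" and i k :: nat
  assumes FG: "is_cell1 F" "is_cell1 G" "tgt F = src G" "i < tgt G" "k < src F"
begin

text \<open>An entry of a composite 1-cell is spanned by the vectors \<open>x \<otimes> y\<close> in one of its summands; 2-cells
  out of composites are evaluated and compared on these vectors.\<close>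

lemma comp1_entry_carr:
  assumes "j < tgt F" "x \<in> carr (ent G i j)" "y \<in> carr (ent F j k)"
  shows "summand j (pure (ent G i j) x y) \<in> carr (ent (F ;\<^sub>1 G) i k)"
  unfolding ent_comp1 using FG assms
  by (intro summand_carr) (auto intro!: fd_tensor pure_carr simp: fd_ent)

lemma comp1_entry_inn:
  assumes "j < tgt F" "x \<in> carr (ent G i j)" "y \<in> carr (ent F j k)"
    and "l < tgt F" "x' \<in> carr (ent G i l)" "y' \<in> carr (ent F l k)"
  shows "inn (ent (F ;\<^sub>1 G) i k) (summand j (pure (ent G i j) x y)) (summand l (pure (ent G i l) x' y')) =
    (if j = l then inn (ent G i j) x x' * inn (ent F j k) y y' else 0)"
  unfolding ent_comp1 using FG assms
  by (subst inn_summand) (auto intro!: fd_tensor pure_carr simp: fd_ent inn_pure)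

lemma comp1_entry_cspan:
  assumes "\<And>j. j < tgt F \<Longrightarrow> cspan (S j) = carr (ent G i j)"
    and "\<And>j. j < tgt F \<Longrightarrow> cspan (T j) = carr (ent F j k)"
  shows "cspan {summand j (pure (ent G i j) x y) |j x y. j < tgt F \<and> x \<in> S j \<and> y \<in> T j} =
    carr (ent (F ;\<^sub>1 G) i k)"
proof -
  have "{summand j (pure (ent G i j) x y) |j x y. j < tgt F \<and> x \<in> S j \<and> y \<in> T j} =
      {summand j t |j t. j < tgt F \<and> t \<in> {pure (ent G i j) x y |x y. x \<in> S j \<and> y \<in> T j}}" by blast
  then show ?thesis unfolding ent_comp1 using FG assms
    by (simp only:) (intro cspan_summand cspan_pure; auto simp: fd_ent intro!: fd_tensor)
qed

end

lemma is_cell2_map: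
  assumes "is_cell2 \<alpha>" "i < tgt (dom2 \<alpha>)" "j < src (dom2 \<alpha>)"
  shows "map2 \<alpha> i j \<in> linear_maps (ent (dom2 \<alpha>) i j) (ent (cod2 \<alpha>) i j)"
  using assms by (simp add: is_cell2_def)

lemma
  assumes "is_cell2 \<alpha>"
  shows is_cell2_dom: "is_cell1 (dom2 \<alpha>)" and is_cell2_tgt: "tgt (cod2 \<alpha>) = tgt (dom2 \<alpha>)"
  using assms by (simp_all add: is_cell2_def)

lemma dom_cod_simps [simp]:
  "dom2 (\<beta> \<cdot> \<alpha>) = dom2 \<alpha>" "cod2 (\<beta> \<cdot> \<alpha>) = cod2 \<beta>"
  "dom2 (\<alpha> ;\<^sub>2 \<gamma>) = dom2 \<alpha> ;\<^sub>1 dom2 \<gamma>" "cod2 (\<alpha> ;\<^sub>2 \<gamma>) = cod2 \<alpha> ;\<^sub>1 cod2 \<gamma>"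
  "dom2 (\<alpha>\<^sup>\<dagger>) = cod2 \<alpha>" "cod2 (\<alpha>\<^sup>\<dagger>) = dom2 \<alpha>"
  "dom2 (scale2 c \<alpha>) = dom2 \<alpha>" "cod2 (scale2 c \<alpha>) = cod2 \<alpha>"
  "dom2 (id2 F) = F" "cod2 (id2 F) = F"
  "dom2 (unit_src F) = F" "cod2 (unit_src F) = id1 (src F) ;\<^sub>1 F"
  "dom2 (unit_tgt F) = F" "cod2 (unit_tgt F) = F ;\<^sub>1 id1 (tgt F)"
  "dom2 (assoc F G K) = F ;\<^sub>1 (G ;\<^sub>1 K)" "cod2 (assoc F G K) = (F ;\<^sub>1 G) ;\<^sub>1 K"
  by (simp_all add: vcomp_def hcomp_def dagger_def scale2_def id2_def unit_src_def unit_tgt_def assoc_def)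

lemma vcomp_apply: "map2 (\<beta> \<cdot> \<alpha>) i j x = map2 \<beta> i j (map2 \<alpha> i j x)"
  by (simp add: vcomp_def)

lemma scale2_apply: "map2 (scale2 c \<alpha>) i j x = c *\<^sub>C map2 \<alpha> i j x"
  by (simp add: scale2_def)

lemma id2_apply: "x \<in> carr (ent F i j) \<Longrightarrow> map2 (id2 F) i j x = x"
  by (simp add: id2_def restr_def)

lemma dagger_map: "map2 (\<alpha>\<^sup>\<dagger>) i j = adj (ent (dom2 \<alpha>) i j) (ent (cod2 \<alpha>) i j) (map2 \<alpha> i j)"
  by (simp add: dagger_def)

lemma is_cell2_vcomp:
  assumes "is_cell2 \<alpha>" "is_cell2 \<beta>" "cod2 \<alpha> = dom2 \<beta>"
  shows "is_cell2 (\<beta> \<cdot> \<alpha>)"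
proof -
  have "map2 \<beta> i j \<circ> map2 \<alpha> i j \<in> linear_maps (ent (dom2 \<alpha>) i j) (ent (cod2 \<beta>) i j)"
    if "i < tgt (dom2 \<alpha>)" "j < src (dom2 \<alpha>)" for i j
    using assms that by (intro linear_maps_comp[of _ _ "ent (dom2 \<beta>) i j"]) (auto simp: is_cell2_def)
  then show ?thesis using assms unfolding is_cell2_def by (simp add: vcomp_def)
qed

lemma is_cell2_dagger:
  assumes "is_cell2 \<alpha>" shows "is_cell2 (\<alpha>\<^sup>\<dagger>)"
  using assms unfolding is_cell2_def by (auto simp: dagger_map fd_ent intro!: adj_linear_maps)

lemma is_cell2_scale2:
  assumes "is_cell2 \<alpha>" shows "is_cell2 (scale2 c \<alpha>)"
proof -
  have "(\<lambda>x. c *\<^sub>C f x) \<in> linear_maps H K" if "f \<in> linear_maps H K" "fd_hilbert K"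
    for f :: "'a \<Rightarrow> 'b" and H K
    using that unfolding linear_maps_def by (auto simp: fd_scale scaleC_add_right scaleC_scaleC mult.commute)
  then show ?thesis using assms unfolding is_cell2_def by (auto simp: scale2_def fd_ent)
qed

lemma is_cell2_id2: "is_cell1 F \<Longrightarrow> is_cell2 (id2 F)"
  unfolding is_cell2_def by (auto simp: id2_def fd_ent intro!: restr_linear_maps)

lemma is_cell2_hcomp:
  assumes \<alpha>: "is_cell2 \<alpha>" and \<beta>: "is_cell2 \<beta>" and eq: "tgt (dom2 \<alpha>) = src (dom2 \<beta>)"
  shows "is_cell2 (\<alpha> ;\<^sub>2 \<beta>)"
proof -
  have D: "is_cell1 (dom2 \<alpha> ;\<^sub>1 dom2 \<beta>)" and C: "is_cell1 (cod2 \<alpha> ;\<^sub>1 cod2 \<beta>)"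
    using assms by (auto simp: is_cell2_def intro!: is_cell1_comp1)
  have "map2 (\<alpha> ;\<^sub>2 \<beta>) i k \<in> linear_maps (ent (dom2 \<alpha> ;\<^sub>1 dom2 \<beta>) i k) (ent (cod2 \<alpha> ;\<^sub>1 cod2 \<beta>) i k)"
    if i: "i < tgt (dom2 \<beta>)" and k: "k < src (dom2 \<alpha>)" for i k
  proof -
    have hyps: "fd_hilbert (ent (dom2 \<beta>) i j)" "fd_hilbert (ent (cod2 \<beta>) i j)"
      "map2 \<beta> i j \<in> linear_maps (ent (dom2 \<beta>) i j) (ent (cod2 \<beta>) i j)"
      "map2 \<alpha> j k \<in> linear_maps (ent (dom2 \<alpha>) j k) (ent (cod2 \<alpha>) j k)" if "j < tgt (dom2 \<alpha>)" for j
      using \<alpha> \<beta> eq that i k by (auto simp: is_cell2_def fd_ent)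
    have T: "T j \<in> carr (tensor (ent (dom2 \<beta>) i j) (ent (dom2 \<alpha>) j k))"
      if "T \<in> carr (ent (dom2 \<alpha> ;\<^sub>1 dom2 \<beta>) i k)" "j < tgt (dom2 \<alpha>)" for T j
      using that by (simp add: ent_comp1 carr_dsum)
    show ?thesis unfolding hcomp_def
    proof (simp, rule restr_linear_maps, goal_cases)
      case 1
      show ?case using D i k by (simp add: fd_ent)
    next
      case (2 T)
      then show ?case unfolding ent_comp1[of "cod2 \<alpha>"] carr_dsum is_cell2_tgt[OF \<alpha>]
        by (auto intro!: tensor_map_carr hyps T)
    next
      case (3 T U)
      then show ?case by (auto simp: fun_eq_iff tensor_map_add[OF hyps T T])
    next
      case (4 T c)
      then show ?case by (auto simp: fun_eq_iff tensor_map_scale[OF hyps T])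
    qed
  qed
  then show ?thesis unfolding is_cell2_def using D C \<alpha> \<beta> by (auto simp: is_cell2_def)
qed

text \<open>In the summands other than \<open>j\<close> the argument is 0, and tensor products of linear maps preserve 0.\<close>

lemma hcomp_apply:
  assumes \<alpha>: "is_cell2 \<alpha>" and \<beta>: "is_cell2 \<beta>" and eq: "tgt (dom2 \<alpha>) = src (dom2 \<beta>)"
    and i: "i < tgt (dom2 \<beta>)" and k: "k < src (dom2 \<alpha>)" and j: "j < tgt (dom2 \<alpha>)"
    and x: "x \<in> carr (ent (dom2 \<beta>) i j)" and y: "y \<in> carr (ent (dom2 \<alpha>) j k)"
  shows "map2 (\<alpha> ;\<^sub>2 \<beta>) i k (summand j (pure (ent (dom2 \<beta>) i j) x y)) =
    summand j (pure (ent (cod2 \<beta>) i j) (map2 \<beta> i j x) (map2 \<alpha> j k y))"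
proof -
  have hyps: "fd_hilbert (ent (dom2 \<beta>) i l)" "fd_hilbert (ent (cod2 \<beta>) i l)"
    "map2 \<beta> i l \<in> linear_maps (ent (dom2 \<beta>) i l) (ent (cod2 \<beta>) i l)"
    "map2 \<alpha> l k \<in> linear_maps (ent (dom2 \<alpha>) l k) (ent (cod2 \<alpha>) l k)" if "l < tgt (dom2 \<alpha>)" for l
    using \<alpha> \<beta> eq that i k by (auto simp: is_cell2_def fd_ent)
  have "summand j (pure (ent (dom2 \<beta>) i j) x y) \<in> carr (ent (dom2 \<alpha> ;\<^sub>1 dom2 \<beta>) i k)"
    using assms by (intro comp1_entry_carr) (auto simp: is_cell2_dom)
  then show ?thesis using j
    by (auto simp: hcomp_def restr_def fun_eq_iff summand_apply tensor_map_zero[OF hyps(4)]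
        tensor_map_pure[OF hyps x y])
qed

lemma is_cell1_id1: "is_cell1 (id1 n)"
  by (simp add: is_cell1_def id1_def fd_hilb_C fd_hilb_zero)

lemma src_tgt_id1 [simp]: "src (id1 n) = n" "tgt (id1 n) = n"
  by (simp_all add: id1_def)

lemma ent_id1: "ent (id1 n) i j = (if i = j then hilb_C else hilb_zero)"
  by (simp add: id1_def)

lemma carr_hilb_C [simp]: "carr hilb_C = UNIV"
  and inn_hilb_C: "inn hilb_C x y = cnj x * y"
  by (simp_all add: hilb_C_def)

lemma unit_src_apply:
  "v \<in> carr (ent F i j) \<Longrightarrow> map2 (unit_src F) i j v = summand j (pure (ent F i j) v 1)"
  by (simp add: unit_src_def restr_def)

lemma unit_src_isometric:
  assumes F: "is_cell1 F" and i: "i < tgt F" and j: "j < src F"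
  shows "isometric (ent F i j) (ent (id1 (src F) ;\<^sub>1 F) i j) (map2 (unit_src F) i j)"
proof -
  have fd: "fd_hilbert (ent F i j)" using assms by (simp add: fd_ent)
  have "restr (ent F i j) (\<lambda>v. summand j (pure (ent F i j) v (1::complex)))
      \<in> linear_maps (ent F i j) (ent (id1 (src F) ;\<^sub>1 F) i j)"
    using assms fd by (intro restr_linear_maps comp1_entry_carr)
      (auto simp: is_cell1_id1 ent_id1 pure_add_left pure_scale_left summand_add summand_scale)
  moreover have "inn (ent (id1 (src F) ;\<^sub>1 F) i j) (summand j (pure (ent F i j) x (1::complex)))
      (summand j (pure (ent F i j) y 1)) = inn (ent F i j) x y"
    if "x \<in> carr (ent F i j)" "y \<in> carr (ent F i j)" for x y
    using assms that by (subst comp1_entry_inn) (auto simp: is_cell1_id1 ent_id1 inn_hilb_C)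
  ultimately show ?thesis by (simp add: isometric_def unit_src_def restr_def)
qed

lemma is_cell2_unit_src: "is_cell1 F \<Longrightarrow> is_cell2 (unit_src F)"
  using unit_src_isometric[of F]
  by (auto simp: is_cell2_def isometric_def intro!: is_cell1_comp1 is_cell1_id1)

lemma unit_tgt_apply:
  "v \<in> carr (ent F i j) \<Longrightarrow> map2 (unit_tgt F) i j v = summand i (pure hilb_C 1 v)"
  by (simp add: unit_tgt_def restr_def)

lemma is_cell2_unit_tgt:
  assumes F: "is_cell1 F" shows "is_cell2 (unit_tgt F)"
proof -
  have "map2 (unit_tgt F) i j \<in> linear_maps (ent F i j) (ent (F ;\<^sub>1 id1 (tgt F)) i j)"
    if i: "i < tgt F" and j: "j < src F" for i j
  proof -
    have "summand i (pure hilb_C 1 v) \<in> carr (ent (F ;\<^sub>1 id1 (tgt F)) i j)"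
      if "v \<in> carr (ent F i j)" for v
      using comp1_entry_carr[OF F is_cell1_id1[of "tgt F"], of i j i 1 v] i j that by (simp add: ent_id1)
    then show ?thesis unfolding unit_tgt_def using F i j
      by (simp, intro restr_linear_maps)
        (auto simp: fd_ent pure_add_right pure_scale_right summand_add summand_scale)
  qed
  then show ?thesis using F by (auto simp: is_cell2_def intro!: is_cell1_comp1 is_cell1_id1)
qed

context
  fixes F :: "'a::complex_vector cell1" and G :: "'b::complex_vector cell1"
    and K :: "'c::complex_vector cell1"
  assumes FGK: "is_cell1 F" "is_cell1 G" "is_cell1 K" "tgt F = src G" "tgt G = src K"
begin

lemma is_cell2_assoc: "is_cell2 (assoc F G K)"
proof -
  have D: "is_cell1 (F ;\<^sub>1 (G ;\<^sub>1 K))" and C: "is_cell1 ((F ;\<^sub>1 G) ;\<^sub>1 K)"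
    using FGK by (auto intro!: is_cell1_comp1)
  have "map2 (assoc F G K) i j \<in> linear_maps (ent (F ;\<^sub>1 (G ;\<^sub>1 K)) i j) (ent ((F ;\<^sub>1 G) ;\<^sub>1 K) i j)"
    if i: "i < tgt K" and j: "j < src F" for i j
    unfolding assoc_def
  proof (simp, rule restr_linear_maps, goal_cases)
    case 1
    show ?case using D i j by (simp add: fd_ent)
  next
    case (2 U)
    have fd: "fd_hilbert (ent K i k)" if "k < tgt G" for k using FGK i that by (simp add: fd_ent)
    have fd': "fd_hilbert (ent G k b)" if "k < tgt G" "b < tgt F" for k b
      using FGK that by (simp add: fd_ent)
    have U: "U b \<in> carr (tensor (ent (G ;\<^sub>1 K) i b) (ent F b j))" if "b < tgt F" for b
      using 2 that by (simp add: ent_comp1[of F] carr_dsum)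
    have sp: "summand k (pure (ent K i k) x y) \<in> carr (ent (G ;\<^sub>1 K) i b)"
      if "k < tgt G" "b < tgt F" "x \<in> carr (ent K i k)" "y \<in> carr (ent G k b)" for k b x y
      using that FGK i by (intro comp1_entry_carr) auto
    note facts = antilinear_carr[OF U sp] antilinear_add[OF U sp sp] antilinear_scale[OF U sp]
    show ?case
      unfolding ent_comp1[of "F ;\<^sub>1 G"] carr_dsum ent_comp1[of F G] carr_tensor antilinear_maps_def
      by (auto simp: fun_eq_iff fd fd' fd_add[OF fd] fd_add[OF fd'] fd_scale[OF fd] fd_scale[OF fd'] facts
          pure_add_left pure_scale_left pure_add_right pure_scale_right summand_add summand_scale)
  next
    case (3 U V)
    then show ?case by (auto simp: fun_eq_iff)
  next
    case (4 U c)
    then show ?case by (auto simp: fun_eq_iff)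
  qed
  then show ?thesis using D C FGK by (auto simp: is_cell2_def)
qed

text \<open>The associator is defined by feeding \<open>x'\<close> and \<open>y'\<close> to its argument as the vector \<open>x' \<otimes> y'\<close> in
  summand \<open>k'\<close>; on a pure tensor this yields \<open>\<langle>x' \<otimes> y'|x \<otimes> y\<rangle> z\<close>, which factorises as
  \<open>\<langle>x'|x\<rangle> \<langle>y'|y\<rangle> z\<close> for equal indices and vanishes otherwise.\<close>

lemma assoc_apply:
  assumes i: "i < tgt K" and j: "j < src F" and k: "k < tgt G" and b: "b < tgt F"
    and x: "x \<in> carr (ent K i k)" and y: "y \<in> carr (ent G k b)" and z: "z \<in> carr (ent F b j)"
  shows "map2 (assoc F G K) i j (summand b (pure (ent (G ;\<^sub>1 K) i b) (summand k (pure (ent K i k) x y)) z)) =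
    summand k (pure (ent K i k) x (summand b (pure (ent G k b) y z)))"
proof -
  let ?s = "summand k (pure (ent K i k) x y)"
  have s: "?s \<in> carr (ent (G ;\<^sub>1 K) i b)" using assms FGK by (intro comp1_entry_carr) auto
  have U: "summand b (pure (ent (G ;\<^sub>1 K) i b) ?s z) \<in> carr (ent (F ;\<^sub>1 (G ;\<^sub>1 K)) i j)"
    using assms FGK s by (intro comp1_entry_carr is_cell1_comp1) auto
  have "(if k' < tgt G \<and> b' < tgt F \<and> x' \<in> carr (ent K i k') \<and> y' \<in> carr (ent G k' b')
        then summand b (pure (ent (G ;\<^sub>1 K) i b) ?s z) b' (summand k' (pure (ent K i k') x' y')) else 0) =
      summand k (pure (ent K i k) x (summand b (pure (ent G k b) y z))) k' x' b' y'"
    (is "(if ?c then ?l else 0) = ?r") for k' x' b' y'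
  proof (cases ?c)
    case True
    note sub = comp1_entry_carr[OF FGK(2,3,5) i, of b' k' x' y']
      comp1_entry_inn[OF FGK(2,3,5) i, of b k' x' y' k x y]
    show ?thesis using True assms sub FGK(4) by (auto simp: summand_apply pure_def restr_def scaleC_scaleC)
  next
    case False
    then show ?thesis using k b by (auto simp: summand_apply pure_def restr_def)
  qed
  then show ?thesis unfolding assoc_def using U by (simp add: restr_def fun_eq_iff)
qed

text \<open>Both inner products of triple tensors in given summands are products of the same
  three inner products, and such tensors span.\<close>

lemma assoc_isometric:
  assumes i: "i < tgt K" and j: "j < src F"
  shows "isometric (ent (F ;\<^sub>1 (G ;\<^sub>1 K)) i j) (ent ((F ;\<^sub>1 G) ;\<^sub>1 K) i j) (map2 (assoc F G K) i j)"
proof -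
  define S where "S b = {summand k (pure (ent K i k) x y) |k x y.
      k < tgt G \<and> x \<in> carr (ent K i k) \<and> y \<in> carr (ent G k b)}" for b
  define S' where "S' = {summand b (pure (ent (G ;\<^sub>1 K) i b) u z) |b u z.
      b < tgt F \<and> u \<in> S b \<and> z \<in> carr (ent F b j)}"
  have GK: "is_cell1 (G ;\<^sub>1 K)" and FG: "is_cell1 (F ;\<^sub>1 G)" using FGK by (auto intro!: is_cell1_comp1)
  have S: "cspan (S b) = carr (ent (G ;\<^sub>1 K) i b)" if "b < tgt F" for b
    unfolding S_def using FGK i j that by (intro comp1_entry_cspan) (auto simp: fd_ent fd_cspan_carr)
  have S': "cspan S' = carr (ent (F ;\<^sub>1 (G ;\<^sub>1 K)) i j)"
    unfolding S'_def using FGK i j S GK by (intro comp1_entry_cspan) (auto simp: fd_ent fd_cspan_carr)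
  have sub: "summand k (pure (ent K i k) x y) \<in> carr (ent (G ;\<^sub>1 K) i b)"
    if "b < tgt F" "k < tgt G" "x \<in> carr (ent K i k)" "y \<in> carr (ent G k b)" for b k x y
    using FGK i that by (intro comp1_entry_carr) auto
  have sub': "summand b (pure (ent G k b) y z) \<in> carr (ent (F ;\<^sub>1 G) k j)"
    if "b < tgt F" "k < tgt G" "y \<in> carr (ent G k b)" "z \<in> carr (ent F b j)" for b k y z
    using FGK j that by (intro comp1_entry_carr) auto
  show ?thesis
  proof (rule isometricI_span[OF _ _ _ S'])
    show "fd_hilbert (ent (F ;\<^sub>1 (G ;\<^sub>1 K)) i j)" "fd_hilbert (ent ((F ;\<^sub>1 G) ;\<^sub>1 K) i j)"
      using FGK GK FG i j by (auto intro!: fd_ent is_cell1_comp1)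
    show "map2 (assoc F G K) i j \<in> linear_maps (ent (F ;\<^sub>1 (G ;\<^sub>1 K)) i j) (ent ((F ;\<^sub>1 G) ;\<^sub>1 K) i j)"
      using is_cell2_map[OF is_cell2_assoc, of i j] i j by simp
    fix u v assume "u \<in> S'" "v \<in> S'"
    then obtain b k x y z b' k' x' y' z' where
      u: "u = summand b (pure (ent (G ;\<^sub>1 K) i b) (summand k (pure (ent K i k) x y)) z)"
        "b < tgt F" "k < tgt G" "x \<in> carr (ent K i k)" "y \<in> carr (ent G k b)" "z \<in> carr (ent F b j)"
      and v: "v = summand b' (pure (ent (G ;\<^sub>1 K) i b') (summand k' (pure (ent K i k') x' y')) z')"
        "b' < tgt F" "k' < tgt G" "x' \<in> carr (ent K i k')" "y' \<in> carr (ent G k' b')" "z' \<in> carr (ent F b' j)"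
      unfolding S'_def S_def by blast
    show "inn (ent ((F ;\<^sub>1 G) ;\<^sub>1 K) i j) (map2 (assoc F G K) i j u) (map2 (assoc F G K) i j v) =
        inn (ent (F ;\<^sub>1 (G ;\<^sub>1 K)) i j) u v"
      using FGK i j u(2-) v(2-) GK FG
      by (auto simp: u(1) v(1) assoc_apply comp1_entry_inn sub sub')
  qed
qed

end

lemma dagger_undo:
  assumes "is_cell2 \<alpha>" "i < tgt (dom2 \<alpha>)" "j < src (dom2 \<alpha>)"
    and "isometric (ent (dom2 \<alpha>) i j) (ent (cod2 \<alpha>) i j) (map2 \<alpha> i j)" "x \<in> carr (ent (dom2 \<alpha>) i j)"
  shows "map2 (\<alpha>\<^sup>\<dagger>) i j (map2 \<alpha> i j x) = x"
  unfolding dagger_map using assms by (intro adj_isometric) (auto simp: is_cell2_def fd_ent)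

section \<open>The bent 2-cell\<close>

lemma W_simps [simp]:
  "src (W\<^sub>L n) = 1" "tgt (W\<^sub>L n) = n" "ent (W\<^sub>L n) i j = hilb_C"
  "src (W\<^sub>R n) = n" "tgt (W\<^sub>R n) = 1" "ent (W\<^sub>R n) i j = hilb_C"
  by (simp_all add: W\<^sub>L_def W\<^sub>R_def)

lemma is_cell1_W: "is_cell1 (W\<^sub>L n)" "is_cell1 (W\<^sub>R n)"
    "is_cell1 (W\<^sub>R n ;\<^sub>1 W\<^sub>L n)" "is_cell1 (W\<^sub>L n ;\<^sub>1 W\<^sub>R n)"
  by (auto simp: is_cell1_def fd_hilb_C intro!: is_cell1_comp1[unfolded is_cell1_def, rule_format])

lemma cspan_one: "cspan {1} = carr hilb_C"
  unfolding complex_vector.span_singleton by (auto simp: scaleC_complex_def)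

lemma std_vec_carr_WL_WR: "i < n \<Longrightarrow> std_vec i \<in> carr (ent (W\<^sub>L n ;\<^sub>1 W\<^sub>R n) 0 0)"
  using comp1_entry_carr[OF is_cell1_W(1,2), of n n 0 0 i 1 1] by (simp add: std_vec_def)

lemma inn_std_vec_WL_WR: "i < n \<Longrightarrow> j < n \<Longrightarrow>
    inn (ent (W\<^sub>L n ;\<^sub>1 W\<^sub>R n) 0 0) (std_vec i) (std_vec j) = (if i = j then 1 else 0)"
  using comp1_entry_inn[OF is_cell1_W(1,2), of n n 0 0 i 1 1 j 1 1] by (simp add: std_vec_def inn_hilb_C)

lemma cspan_std_vec_WL_WR: "cspan (std_vec ` {..<n}) = carr (ent (W\<^sub>L n ;\<^sub>1 W\<^sub>R n) 0 0)"
proof -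
  have "cspan {summand k (pure (ent (W\<^sub>R n) 0 k) x y) |k x y. k < tgt (W\<^sub>L n) \<and> x \<in> {1} \<and> y \<in> {1}} =
      carr (ent (W\<^sub>L n ;\<^sub>1 W\<^sub>R n) 0 0)"
    by (intro comp1_entry_cspan is_cell1_W) (simp_all add: cspan_one)
  moreover have "{summand k (pure (ent (W\<^sub>R n) 0 k) x y) |k x y. k < tgt (W\<^sub>L n) \<and> x \<in> {1} \<and> y \<in> {1}} =
      std_vec ` {..<n}"
    by (auto simp: std_vec_def)
  ultimately show ?thesis by (simp only:)
qed

text \<open>An entry of \<open>W\<^sub>R ; W\<^sub>L\<close> is a direct sum with a single summand \<open>\<complex> \<otimes> \<complex>\<close>, so \<open>std_vec 0\<close> is also its
  unit basis vector.\<close>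

lemma std_vec_carr_WR_WL: "i < n \<Longrightarrow> j < n \<Longrightarrow> std_vec 0 \<in> carr (ent (W\<^sub>R n ;\<^sub>1 W\<^sub>L n) i j)"
  using comp1_entry_carr[OF is_cell1_W(2,1), of n n i j 0 1 1] by (simp add: std_vec_def)

lemma inn_std_vec_WR_WL: "i < n \<Longrightarrow> j < n \<Longrightarrow>
    inn (ent (W\<^sub>R n ;\<^sub>1 W\<^sub>L n) i j) (std_vec 0) (std_vec 0) = 1"
  using comp1_entry_inn[OF is_cell1_W(2,1), of n n i j 0 1 1 0 1 1] by (simp add: std_vec_def inn_hilb_C)

lemma WR_WL_cases:
  assumes "i < n" "j < n" "x \<in> carr (ent (W\<^sub>R n ;\<^sub>1 W\<^sub>L n) i j)"
  obtains c where "x = c *\<^sub>C std_vec 0"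
proof -
  have "cspan {summand k (pure (ent (W\<^sub>L n) i k) x y) |k x y. k < tgt (W\<^sub>R n) \<and> x \<in> {1} \<and> y \<in> {1}} =
      carr (ent (W\<^sub>R n ;\<^sub>1 W\<^sub>L n) i j)"
    using assms by (intro comp1_entry_cspan is_cell1_W) (simp_all add: cspan_one)
  moreover have "{summand k (pure (ent (W\<^sub>L n) i k) x y) |k x y. k < tgt (W\<^sub>R n) \<and> x \<in> {1} \<and> y \<in> {1}} =
      {std_vec 0}"
    by (auto simp: std_vec_def)
  ultimately have "carr (ent (W\<^sub>R n ;\<^sub>1 W\<^sub>L n) i j) = range (\<lambda>c. c *\<^sub>C std_vec 0)"
    by (simp only: complex_vector.span_singleton)
  then show thesis using that assms by auto
qed

lemma dom_cod_Copy [simp]: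
  "dom2 (Copy n) = id1 n" "cod2 (Copy n) = W\<^sub>R n ;\<^sub>1 W\<^sub>L n"
  "dom2 (Compare n) = W\<^sub>R n ;\<^sub>1 W\<^sub>L n" "cod2 (Compare n) = id1 n"
  by (simp_all add: Copy_def Compare_def)

lemma Copy_isometric:
  assumes "i < n"
  shows "isometric (ent (id1 n) i i) (ent (W\<^sub>R n ;\<^sub>1 W\<^sub>L n) i i) (map2 (Copy n) i i)"
proof -
  have "summand 0 (pure hilb_C z 1) \<in> carr (ent (W\<^sub>R n ;\<^sub>1 W\<^sub>L n) i i)"
    and "inn (ent (W\<^sub>R n ;\<^sub>1 W\<^sub>L n) i i) (summand 0 (pure hilb_C z 1)) (summand 0 (pure hilb_C z' 1)) = cnj z * z'"
    for z z' :: complex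
    using comp1_entry_carr[OF is_cell1_W(2,1), of n n i i 0 z 1]
      comp1_entry_inn[OF is_cell1_W(2,1), of n n i i 0 z 1 0 z' 1] assms by (simp_all add: inn_hilb_C)
  then show ?thesis
    unfolding isometric_def linear_maps_def
    by (simp add: ent_id1 Copy_def inn_hilb_C pure_add_left[OF fd_hilb_C] pure_scale_left[OF fd_hilb_C]
        summand_add summand_scale)
qed

lemma is_cell2_Copy: "is_cell2 (Copy n)"
proof -
  have "map2 (Copy n) i j \<in> linear_maps (ent (id1 n) i j) (ent (W\<^sub>R n ;\<^sub>1 W\<^sub>L n) i j)" if "i < n" "j < n" for i j
  proof (cases "i = j")
    case True
    then show ?thesis using Copy_isometric[OF that(1)] by (simp add: isometric_def)
  next
    case False
    then show ?thesis using fd_zero[OF fd_ent[OF is_cell1_W(3)], of i n j] that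
      by (simp add: Copy_def linear_maps_def)
  qed
  then show ?thesis by (simp add: is_cell2_def is_cell1_id1 is_cell1_W)
qed

lemma Copy_one: "map2 (Copy n) i i 1 = std_vec 0"
  by (simp add: Copy_def std_vec_def)

lemma is_cell2_Compare: "is_cell2 (Compare n)"
  unfolding Compare_def by (rule is_cell2_dagger[OF is_cell2_Copy])

text \<open>Compare is 0 off the diagonal, as it takes values in the zero space there; on the diagonal it
  undoes the isometry Copy.\<close>

lemma Compare_std_vec:
  assumes "i < n" "j < n"
  shows "map2 (Compare n) i j (std_vec 0) = (if i = j then 1 else 0)"
proof (cases "i = j")
  case True
  then show ?thesis
    using dagger_undo[OF is_cell2_Copy, of i n i 1] Copy_isometric[OF assms(1)] assms
    by (simp add: Compare_def Copy_one ent_id1)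
next
  case False
  have "map2 (Compare n) i j (std_vec 0) \<in> carr (ent (id1 n) i j)"
    using linear_maps_carr[OF is_cell2_map[OF is_cell2_Compare, of i n j], of "std_vec 0"]
      std_vec_carr_WR_WL[OF assms] assms by simp
  then show ?thesis using False by (simp add: ent_id1 hilb_zero_def)
qed

lemma bend_cells:
  "is_cell2 (unit_src (W\<^sub>R n ;\<^sub>1 W\<^sub>L n))" "is_cell2 (unit_tgt (W\<^sub>R n ;\<^sub>1 W\<^sub>L n))"
  "is_cell2 (id2 (W\<^sub>R n ;\<^sub>1 W\<^sub>L n))" "is_cell2 (id2 (W\<^sub>R n))" "is_cell2 (id2 (W\<^sub>L n))"
  "is_cell2 (assoc (W\<^sub>R n ;\<^sub>1 W\<^sub>L n) (W\<^sub>R n) (W\<^sub>L n))" "is_cell2 (assoc (W\<^sub>R n) (W\<^sub>L n) (W\<^sub>R n))"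
  by (simp_all add: is_cell2_unit_src is_cell2_unit_tgt is_cell2_id2 is_cell2_assoc is_cell1_W)

context
  fixes n :: nat and K :: "(nat \<Rightarrow> complex \<Rightarrow> complex, nat \<Rightarrow> complex \<Rightarrow> complex) cell2"
  assumes K: "is_cell2 K" "dom2 K = W\<^sub>L n ;\<^sub>1 W\<^sub>R n" "cod2 K = W\<^sub>L n ;\<^sub>1 W\<^sub>R n"
begin

private abbreviation (input) "A \<equiv> W\<^sub>R n"
private abbreviation (input) "B \<equiv> W\<^sub>L n"
private abbreviation (input) "W \<equiv> W\<^sub>R n ;\<^sub>1 W\<^sub>L n"
private abbreviation (input) "V \<equiv> ent (W\<^sub>L n ;\<^sub>1 W\<^sub>R n) 0 0"

lemma is_cell2_bend: "is_cell2 (bend n K)"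
  unfolding bend_def Let_def
  by (intro is_cell2_vcomp is_cell2_hcomp is_cell2_dagger bend_cells is_cell2_Copy is_cell2_Compare K)
    (simp_all add: K)

context
  fixes i j :: nat
  assumes i: "i < n" and j: "j < n"
begin

lemma assoc_ABA:
  assumes "k < n"
  shows "map2 (assoc A B A) 0 j (summand 0 (pure V (std_vec k) 1)) = summand k (pure hilb_C 1 (std_vec 0))"
    and "summand 0 (pure V (std_vec k) 1) \<in> carr (ent (A ;\<^sub>1 (B ;\<^sub>1 A)) 0 j)"
    and "summand k (pure hilb_C 1 (std_vec 0)) \<in> carr (ent (W ;\<^sub>1 A) 0 j)"
  using assoc_apply[of A B A 0 j k 0 1 1 1] assms j is_cell1_W
    comp1_entry_carr[of A "B ;\<^sub>1 A" 0 j 0 "std_vec k" 1] std_vec_carr_WL_WR[OF assms]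
    comp1_entry_carr[of W A 0 j k 1 "std_vec 0"] std_vec_carr_WR_WL[OF assms j]
  by (simp_all add: std_vec_def)

lemma assoc_ABA_dagger:
  assumes "k < n"
  shows "map2 ((assoc A B A)\<^sup>\<dagger>) 0 j (summand k (pure hilb_C 1 (std_vec 0))) = summand 0 (pure V (std_vec k) 1)"
  using dagger_undo[OF bend_cells(7)[of n], of 0 j] assoc_isometric[of A B A 0 j] assoc_ABA[OF assms] j is_cell1_W
  by simp metis

lemma assoc_WAB:
  assumes "k < n"
  shows "map2 (assoc W A B) i j (summand k (pure (ent W i k) (std_vec 0) (std_vec 0))) =
      summand 0 (pure hilb_C 1 (summand k (pure hilb_C 1 (std_vec 0))))"
    and "summand k (pure (ent W i k) (std_vec 0) (std_vec 0)) \<in> carr (ent (W ;\<^sub>1 W) i j)"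
  using assoc_apply[of W A B i j 0 k 1 1 "std_vec 0"] assms i j is_cell1_W
    comp1_entry_carr[of W W i j k "std_vec 0" "std_vec 0"]
    std_vec_carr_WR_WL[OF i assms] std_vec_carr_WR_WL[OF assms j]
  by (simp_all add: std_vec_def[of 0])

lemma assoc_WAB_dagger:
  assumes "k < n"
  shows "map2 ((assoc W A B)\<^sup>\<dagger>) i j (summand 0 (pure hilb_C 1 (summand k (pure hilb_C 1 (std_vec 0))))) =
    summand k (pure (ent W i k) (std_vec 0) (std_vec 0))"
  using dagger_undo[OF bend_cells(6)[of n], of i j] assoc_isometric[of W A B i j] assoc_WAB[OF assms] i j is_cell1_W
  by simp metis

text \<open>Copy inserts a basis vector with index \<open>i\<close>, the row of the entry under consideration, and the
  associators move it into the argument of \<open>K\<close>.\<close>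

lemma bend_head:
  "map2 (((id2 A ;\<^sub>2 K) ;\<^sub>2 id2 B) \<cdot> ((assoc A B A)\<^sup>\<dagger> ;\<^sub>2 id2 B) \<cdot> assoc W A B
      \<cdot> (id2 W ;\<^sub>2 Copy n) \<cdot> unit_tgt W) i j (std_vec 0) =
    summand 0 (pure hilb_C 1 (summand 0 (pure V (map2 K 0 0 (std_vec i)) 1)))"
proof -
  note w = std_vec_carr_WR_WL[OF i j] std_vec_carr_WR_WL[OF i i]
  have 1: "map2 (unit_tgt W) i j (std_vec 0) = summand i (pure hilb_C 1 (std_vec 0))"
    by (rule unit_tgt_apply[OF w(1)])
  have 2: "map2 (id2 W ;\<^sub>2 Copy n) i j (summand i (pure hilb_C 1 (std_vec 0))) =
      summand i (pure (ent W i i) (std_vec 0) (std_vec 0))"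
    using hcomp_apply[OF bend_cells(3)[of n] is_cell2_Copy, of n i j i 1 "std_vec 0"] i j w
    by (simp add: ent_id1 Copy_one id2_apply)
  have 3: "map2 ((assoc A B A)\<^sup>\<dagger> ;\<^sub>2 id2 B) i j (summand 0 (pure hilb_C 1 (summand i (pure hilb_C 1 (std_vec 0))))) =
      summand 0 (pure hilb_C 1 (summand 0 (pure V (std_vec i) 1)))"
    using hcomp_apply[OF is_cell2_dagger[OF bend_cells(7)[of n]] bend_cells(5)[of n], of i j 0 1
        "summand i (pure hilb_C 1 (std_vec 0))"] i j
      assoc_ABA(3)[OF i] by (simp add: id2_apply assoc_ABA_dagger)
  have 4: "map2 (id2 A ;\<^sub>2 K) 0 j (summand 0 (pure V (std_vec i) 1)) =
      summand 0 (pure V (map2 K 0 0 (std_vec i)) 1)"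
    using hcomp_apply[OF bend_cells(4)[of n] K(1), of 0 j 0 "std_vec i" 1] i j std_vec_carr_WL_WR[OF i]
    by (simp add: K id2_apply)
  have 5: "map2 ((id2 A ;\<^sub>2 K) ;\<^sub>2 id2 B) i j (summand 0 (pure hilb_C 1 (summand 0 (pure V (std_vec i) 1)))) =
      summand 0 (pure hilb_C 1 (summand 0 (pure V (map2 K 0 0 (std_vec i)) 1)))"
    using hcomp_apply[OF is_cell2_hcomp[OF bend_cells(4)[of n] K(1)]
        bend_cells(5)[of n], of i j 0 1 "summand 0 (pure V (std_vec i) 1)"] i j
      assoc_ABA(2)[OF i] by (simp add: K id2_apply 4)
  show ?thesis by (simp add: vcomp_apply 1 2 3 5 assoc_WAB(1)[OF i])
qed

private abbreviation (input) 
  "tail \<equiv> (unit_src W)\<^sup>\<dagger> \<cdot> (Compare n ;\<^sub>2 id2 W) \<cdot> (assoc W A B)\<^sup>\<dagger> \<cdot> (assoc A B A ;\<^sub>2 id2 B)"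

lemma bend_tail_std_vec:
  assumes "k < n"
  shows "map2 tail i j (summand 0 (pure hilb_C 1 (summand 0 (pure V (std_vec k) 1)))) =
    (if k = j then std_vec 0 else 0)"
proof -
  note w = std_vec_carr_WR_WL[OF assms j] std_vec_carr_WR_WL[OF i assms] std_vec_carr_WR_WL[OF i j]
  have 1: "map2 (assoc A B A ;\<^sub>2 id2 B) i j (summand 0 (pure hilb_C 1 (summand 0 (pure V (std_vec k) 1)))) =
      summand 0 (pure hilb_C 1 (summand k (pure hilb_C 1 (std_vec 0))))"
    using hcomp_apply[OF bend_cells(7)[of n] bend_cells(5)[of n], of i j 0 1
        "summand 0 (pure V (std_vec k) 1)"] i j
      assoc_ABA[OF assms] by (simp add: id2_apply)
  have 2: "map2 (Compare n ;\<^sub>2 id2 W) i j (summand k (pure (ent W i k) (std_vec 0) (std_vec 0))) =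
      summand k (pure (ent W i k) (std_vec 0) (if k = j then 1 else 0))"
    using hcomp_apply[OF is_cell2_Compare bend_cells(3)[of n], of n i j k "std_vec 0" "std_vec 0"] i j assms w
    by (simp add: id2_apply Compare_std_vec)
  have 3: "map2 ((unit_src W)\<^sup>\<dagger>) i j (summand j (pure (ent W i j) (std_vec 0) 1)) = std_vec 0"
    using dagger_undo[OF bend_cells(1)[of n], of i j "std_vec 0"] unit_src_isometric[of W i j] i j w(3)
    by (simp add: unit_src_apply is_cell1_W)
  have 4: "map2 ((unit_src W)\<^sup>\<dagger>) i j 0 = 0"
    using linear_maps_zero[OF is_cell2_map[OF is_cell2_dagger[OF bend_cells(1)[of n]], of i j]] i j by simp
  show ?thesis using 3 4 by (auto simp: vcomp_apply 1 2 assoc_WAB_dagger[OF assms])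
qed

text \<open>The second half of the bending, applied to a vector of \<open>\<complex>\<^sup>n\<close>, reads off a coordinate:
  by linearity this is checked on the standard basis.\<close>

lemma bend_tail:
  assumes v: "v \<in> carr V"
  shows "map2 tail i j (summand 0 (pure hilb_C 1 (summand 0 (pure V v 1)))) =
    inn V (std_vec j) v *\<^sub>C std_vec 0"
proof -
  have fdV: "fd_hilbert V" by (rule fd_ent[OF is_cell1_W(4)]) simp_all
  have "is_cell2 tail"
    by (intro is_cell2_vcomp is_cell2_hcomp is_cell2_dagger bend_cells is_cell2_Compare) simp_all
  then have lin: "map2 tail i j \<in> linear_maps (ent ((A ;\<^sub>1 (B ;\<^sub>1 A)) ;\<^sub>1 B) i j) (ent W i j)"
    using is_cell2_map[of tail i j] i j by simp
  have emb: "summand 0 (pure hilb_C 1 (summand 0 (pure V u 1))) \<in> carr (ent ((A ;\<^sub>1 (B ;\<^sub>1 A)) ;\<^sub>1 B) i j)"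
    if "u \<in> carr V" for u
    using comp1_entry_carr[of A "B ;\<^sub>1 A" 0 j 0 u 1] that i j
      comp1_entry_carr[of "A ;\<^sub>1 (B ;\<^sub>1 A)" B i j 0 1 "summand 0 (pure V u 1)"]
    by (simp add: is_cell1_W is_cell1_comp1)
  note e = std_vec_carr_WL_WR[OF j]
  show ?thesis using v unfolding cspan_std_vec_WL_WR[symmetric]
  proof (induction rule: cspan_induct_on)
    case (base v)
    then show ?case using j by (auto simp del: dom_cod_simps simp: bend_tail_std_vec inn_std_vec_WL_WR scaleC_one)
  next
    case zero
    show ?case using inn_zero_right[OF fdV e] linear_maps_zero[OF lin]
      by (simp only: pure_zero_left[OF fdV] summand_zero pure_zero_right scaleC_zero_left)
  next
    case (add x y)
    then have xy: "x \<in> carr V" "y \<in> carr V" by (simp_all add: cspan_std_vec_WL_WR)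
    show ?case using add(3,4)
      by (simp only: pure_add_left[OF fdV xy] summand_add pure_add_right linear_maps_add[OF lin emb emb] xy
          inn_add_right[OF fdV e xy] scaleC_add_left)
  next
    case (scale c x)
    then have x: "x \<in> carr V" by (simp add: cspan_std_vec_WL_WR)
    show ?case using scale(2)
      by (simp only: pure_scale_left[OF fdV x] summand_scale pure_scale_right linear_maps_scale[OF lin emb] x
          inn_scale_right[OF fdV e x] scaleC_scaleC)
  qed
qed

text \<open>The two indices of a matrix element of \<open>K\<close> become the row and column of an entry of the bent
  2-cell.\<close>

lemma bend_apply:
  "map2 (bend n K) i j (std_vec 0) = inn V (std_vec j) (map2 K 0 0 (std_vec i)) *\<^sub>C std_vec 0"
proof -
  have "map2 K 0 0 (std_vec i) \<in> carr V"
    using linear_maps_carr[OF is_cell2_map[OF K(1), of 0 0]] std_vec_carr_WL_WR[OF i] by (simp add: K)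
  from bend_tail[OF this] show ?thesis
    using bend_head by (simp add: bend_def Let_def vcomp_apply)
qed

end

end

lemma dom_cod_bend [simp]:
  "dom2 (bend n K) = W\<^sub>R n ;\<^sub>1 W\<^sub>L n" "cod2 (bend n K) = W\<^sub>R n ;\<^sub>1 W\<^sub>L n"
  by (simp_all add: bend_def Let_def)

text \<open>On a one-dimensional space the adjoint of multiplication by \<open>\<kappa>\<close> is multiplication by the complex conjugate
  of \<open>\<kappa>\<close>, so both composites with the adjoint are multiplication by \<open>|\<kappa>|\<^sup>2\<close>.\<close>

lemma unitary2_entrywise_scalar:
  assumes \<alpha>: "is_cell2 \<alpha>" "dom2 \<alpha> = W\<^sub>R n ;\<^sub>1 W\<^sub>L n" "cod2 \<alpha> = W\<^sub>R n ;\<^sub>1 W\<^sub>L n"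
    and \<kappa>: "\<And>i j. i < n \<Longrightarrow> j < n \<Longrightarrow> map2 \<alpha> i j (std_vec 0) = \<kappa> i j *\<^sub>C std_vec 0"
  shows "unitary2 \<alpha> \<longleftrightarrow> (\<forall>i<n. \<forall>j<n. cmod (\<kappa> i j) = 1)"
proof -
  let ?W = "W\<^sub>R n ;\<^sub>1 W\<^sub>L n"
  have unit: "\<kappa> i j * cnj (\<kappa> i j) = 1 \<longleftrightarrow> cmod (\<kappa> i j) = 1" for i j
    by (metis complex_norm_square norm_ge_zero of_real_eq_1_iff power2_eq_1_iff power_one
        abs_norm_cancel abs_one power2_eq_iff_nonneg zero_le_one)
  have entry: "(map2 (\<alpha>\<^sup>\<dagger> \<cdot> \<alpha>) i j = map2 (id2 ?W) i j \<longleftrightarrow> cmod (\<kappa> i j) = 1) \<and>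
      (map2 (\<alpha> \<cdot> \<alpha>\<^sup>\<dagger>) i j = map2 (id2 ?W) i j \<longleftrightarrow> cmod (\<kappa> i j) = 1)"
    if i: "i < n" and j: "j < n" for i j
  proof -
    let ?H = "ent ?W i j" and ?f = "map2 \<alpha> i j" and ?g = "map2 (\<alpha>\<^sup>\<dagger>) i j"
    have fd: "fd_hilbert ?H" using i j by (simp add: fd_ent is_cell1_W)
    note w = std_vec_carr_WR_WL[OF i j] and ww = inn_std_vec_WR_WL[OF i j]
    have f: "?f \<in> linear_maps ?H ?H" using is_cell2_map[OF \<alpha>(1)] \<alpha> i j by simp
    have g: "?g \<in> linear_maps ?H ?H" using is_cell2_map[OF is_cell2_dagger[OF \<alpha>(1)]] \<alpha> i j by simp
    have gw: "?g (std_vec 0) = cnj (\<kappa> i j) *\<^sub>C std_vec 0"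
      unfolding dagger_map \<alpha>
    proof (rule adj_eqI[OF fd fd f w fd_scale[OF fd w]])
      fix z assume "z \<in> carr ?H"
      then obtain c where "z = c *\<^sub>C std_vec 0" using WR_WL_cases[OF i j] by blast
      then show "inn ?H (cnj (\<kappa> i j) *\<^sub>C std_vec 0) z = inn ?H (std_vec 0) (?f z)"
        using fd w ww \<kappa>[OF i j]
        by (simp add: inn_scale_left inn_scale_right fd_scale linear_maps_scale[OF f])
    qed
    have iff: "h = map2 (id2 ?W) i j \<longleftrightarrow> cmod (\<kappa> i j) = 1"
      if lin: "h \<in> linear_maps ?H ?H"
        and hw0: "h (std_vec 0) = (\<kappa> i j * cnj (\<kappa> i j)) *\<^sub>C std_vec 0" for h
    proof
      assume "h = map2 (id2 ?W) i j"
      then have "(\<kappa> i j * cnj (\<kappa> i j)) *\<^sub>C std_vec 0 = std_vec 0" using hw0 w by (simp add: id2_apply)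
      then have "inn ?H (std_vec 0) ((\<kappa> i j * cnj (\<kappa> i j)) *\<^sub>C std_vec 0) = 1" using ww by simp
      then show "cmod (\<kappa> i j) = 1" using fd w ww by (simp add: inn_scale_right unit)
    next
      assume "cmod (\<kappa> i j) = 1"
      then have "\<kappa> i j * cnj (\<kappa> i j) = 1" by (rule unit[THEN iffD2])
      then have hw: "h (std_vec 0) = std_vec 0" using hw0 by (simp only: scaleC_one)
      show "h = map2 (id2 ?W) i j"
      proof
        fix x show "h x = map2 (id2 ?W) i j x"
        proof (cases "x \<in> carr ?H")
          case True
          then obtain c where "x = c *\<^sub>C std_vec 0" using WR_WL_cases[OF i j] by blast
          then show ?thesis using True hw w by (simp add: id2_apply linear_maps_scale[OF lin])
        next
          case False
          then show ?thesis using linear_maps_outside[OF lin] by (simp add: id2_def restr_def)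
        qed
      qed
    qed
    have comp: "?g \<circ> ?f \<in> linear_maps ?H ?H" "?f \<circ> ?g \<in> linear_maps ?H ?H"
      using f g by (auto intro: linear_maps_comp)
    have "(?g \<circ> ?f) (std_vec 0) = (\<kappa> i j * cnj (\<kappa> i j)) *\<^sub>C std_vec 0"
      using w \<kappa>[OF i j] gw by (simp add: linear_maps_scale[OF g] scaleC_scaleC)
    moreover have "(?f \<circ> ?g) (std_vec 0) = (\<kappa> i j * cnj (\<kappa> i j)) *\<^sub>C std_vec 0"
      using w \<kappa>[OF i j] gw by (simp add: linear_maps_scale[OF f] scaleC_scaleC mult.commute)
    ultimately show ?thesis
      unfolding vcomp_def using iff[OF comp(1)] iff[OF comp(2)] by simp
  qed
  then show ?thesis unfolding unitary2_def eq2_def using \<alpha> by auto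
qed

section \<open>Measurements and complementarity\<close>

lemma hilb_cell_simps [simp]: "src (hilb_cell H) = 1" "tgt (hilb_cell H) = 1" "ent (hilb_cell H) i j = H"
  by (simp_all add: hilb_cell_def)

context
  fixes H :: "'h::complex_vector hspace" and n :: nat
    and M :: "('h, nat \<Rightarrow> complex \<Rightarrow> complex) cell2"
  assumes H: "fd_hilbert H" and M: "measurement n H M"
begin

private abbreviation (input) "Cn \<equiv> ent (W\<^sub>L n ;\<^sub>1 W\<^sub>R n) 0 0"

lemma measurement_cell: "is_cell2 M" "dom2 M = hilb_cell H" "cod2 M = W\<^sub>L n ;\<^sub>1 W\<^sub>R n"
  using M by (simp_all add: measurement_def unitary2_def)

lemma measurement_map: "map2 M 0 0 \<in> linear_maps H Cn"
  using is_cell2_map[OF measurement_cell(1), of 0 0] by (simp add: measurement_cell)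

lemma measurement_dagger_map: "map2 (M\<^sup>\<dagger>) 0 0 \<in> linear_maps Cn H"
  using is_cell2_map[OF is_cell2_dagger[OF measurement_cell(1)], of 0 0] by (simp add: measurement_cell)

lemma measurement_inverse:
  shows "x \<in> carr H \<Longrightarrow> map2 (M\<^sup>\<dagger>) 0 0 (map2 M 0 0 x) = x"
    and "v \<in> carr Cn \<Longrightarrow> map2 M 0 0 (map2 (M\<^sup>\<dagger>) 0 0 v) = v"
proof -
  have "map2 (M\<^sup>\<dagger> \<cdot> M) 0 0 = map2 (id2 (hilb_cell H)) 0 0"
    and "map2 (M \<cdot> M\<^sup>\<dagger>) 0 0 = map2 (id2 (W\<^sub>L n ;\<^sub>1 W\<^sub>R n)) 0 0"
    using M by (simp_all add: measurement_def unitary2_def eq2_def)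
  then show "x \<in> carr H \<Longrightarrow> map2 (M\<^sup>\<dagger>) 0 0 (map2 M 0 0 x) = x"
    "v \<in> carr Cn \<Longrightarrow> map2 M 0 0 (map2 (M\<^sup>\<dagger>) 0 0 v) = v"
    by (metis vcomp_apply id2_apply hilb_cell_simps(3))+
qed

lemma measurement_inn:
  assumes "x \<in> carr H" "y \<in> carr H"
  shows "inn Cn (map2 M 0 0 x) (map2 M 0 0 y) = inn H x y"
  using adj_inn[OF H fd_ent[OF is_cell1_W(4)] measurement_map linear_maps_carr[OF measurement_map assms(1)] assms(2)]
    assms measurement_inverse(1)[OF assms(1)]
  by (simp add: dagger_map measurement_cell)

text \<open>The outcome basis is defined by an inverse function on the carrier; expressing it through the
  adjoint makes it accessible to the calculus of 2-cells.\<close>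

lemma meas_basis_eq:
  assumes "i < n"
  shows "meas_basis H M i = map2 (M\<^sup>\<dagger>) 0 0 (std_vec i)"
  unfolding meas_basis_def
proof (rule inv_into_f_eq)
  show "inj_on (map2 M 0 0) (carr H)" using measurement_inverse(1) by (metis inj_onI)
  show "map2 (M\<^sup>\<dagger>) 0 0 (std_vec i) \<in> carr H"
    by (rule linear_maps_carr[OF measurement_dagger_map std_vec_carr_WL_WR[OF assms]])
  show "map2 M 0 0 (map2 (M\<^sup>\<dagger>) 0 0 (std_vec i)) = std_vec i"
    by (rule measurement_inverse(2)[OF std_vec_carr_WL_WR[OF assms]])
qed

lemma
  assumes "i < n"
  shows meas_basis_carr: "meas_basis H M i \<in> carr H"
    and measurement_meas_basis: "map2 M 0 0 (meas_basis H M i) = std_vec i"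
  using linear_maps_carr[OF measurement_dagger_map std_vec_carr_WL_WR[OF assms]]
    measurement_inverse(2)[OF std_vec_carr_WL_WR[OF assms]] meas_basis_eq[OF assms] by simp_all

lemma meas_basis_orthonormal:
  assumes "i < n" "j < n"
  shows "inn H (meas_basis H M i) (meas_basis H M j) = (if i = j then 1 else 0)"
  using measurement_inn[OF meas_basis_carr meas_basis_carr] assms
  by (simp add: measurement_meas_basis inn_std_vec_WL_WR)

lemma meas_basis_inj: "inj_on (meas_basis H M) {..<n}"
  using meas_basis_orthonormal by (auto intro!: inj_onI) (metis zero_neq_one)

lemma meas_basis_onb: "is_onb H (meas_basis H M ` {..<n})"
proof -
  let ?a = "meas_basis H M"
  have *: "map2 (M\<^sup>\<dagger>) 0 0 v \<in> cspan (?a ` {..<n})" if "v \<in> cspan (std_vec ` {..<n})" for v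
    using that
  proof (induction rule: cspan_induct_on)
    case (base v)
    then show ?case by (auto simp: meas_basis_eq[symmetric] intro!: complex_vector.span_base)
  next
    case zero
    then show ?case using linear_maps_zero[OF measurement_dagger_map] complex_vector.span_zero by metis
  next
    case (add v w)
    then show ?case using linear_maps_add[OF measurement_dagger_map, of v w]
      by (simp only: cspan_std_vec_WL_WR complex_vector.span_add)
  next
    case (scale c v)
    then show ?case using linear_maps_scale[OF measurement_dagger_map, of v c]
      by (simp only: cspan_std_vec_WL_WR complex_vector.span_scale)
  qed
  have "carr H \<subseteq> cspan (?a ` {..<n})"
  proof
    fix x assume x: "x \<in> carr H"
    then have "map2 M 0 0 x \<in> cspan (std_vec ` {..<n})"
      unfolding cspan_std_vec_WL_WR by (rule linear_maps_carr[OF measurement_map])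
    from *[OF this] show "x \<in> cspan (?a ` {..<n})" using measurement_inverse(1)[OF x] by simp
  qed
  moreover have "cspan (?a ` {..<n}) \<subseteq> carr H"
    using meas_basis_carr by (intro fd_span[OF H]) auto
  moreover have "inn H x y = (if x = y then 1 else 0)" if "x \<in> ?a ` {..<n}" "y \<in> ?a ` {..<n}" for x y
    using that meas_basis_orthonormal meas_basis_inj by (auto simp: inj_on_eq_iff)
  ultimately show ?thesis by (auto simp: is_onb_def)
qed

lemma measurement_hdim: "hdim H = n"
  using onb_hdim[OF H meas_basis_onb] meas_basis_inj by (simp add: card_image)

lemma meas_basis_parseval:
  assumes "x \<in> carr H" "inn H x x = 1"
  shows "(\<Sum>i<n. (cmod (inn H (meas_basis H M i) x))\<^sup>2) = 1"
proof -
  have "complex_of_real (\<Sum>i<n. (cmod (inn H (meas_basis H M i) x))\<^sup>2) =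
      (\<Sum>i<n. cnj (inn H (meas_basis H M i) x) * inn H (meas_basis H M i) x)"
    unfolding of_real_sum complex_norm_square by (intro sum.cong refl mult.commute)
  also have "\<dots> = 1"
    using onb_parseval[OF H meas_basis_onb assms(1,1)] assms(2) meas_basis_inj
    by (simp add: sum.reindex)
  finally show ?thesis by (simp only: of_real_eq_1_iff)
qed

end

lemma
  assumes H: "fd_hilbert H" and R: "measurement n H R" and G: "measurement n H G"
  shows is_cell2_prep_meas: "is_cell2 (G \<cdot> R\<^sup>\<dagger>)"
    and prep_meas_entry: "i < n \<Longrightarrow> j < n \<Longrightarrow>
      inn (ent (W\<^sub>L n ;\<^sub>1 W\<^sub>R n) 0 0) (std_vec j) (map2 (G \<cdot> R\<^sup>\<dagger>) 0 0 (std_vec i)) =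
      inn H (meas_basis H G j) (meas_basis H R i)"
proof -
  show "is_cell2 (G \<cdot> R\<^sup>\<dagger>)"
    using measurement_cell[OF H R] measurement_cell[OF H G]
    by (intro is_cell2_vcomp is_cell2_dagger) simp_all
  assume "i < n" "j < n"
  then show "inn (ent (W\<^sub>L n ;\<^sub>1 W\<^sub>R n) 0 0) (std_vec j) (map2 (G \<cdot> R\<^sup>\<dagger>) 0 0 (std_vec i)) =
      inn H (meas_basis H G j) (meas_basis H R i)"
    using measurement_inn[OF H G meas_basis_carr[OF H G] meas_basis_carr[OF H R], of j i]
    by (simp add: vcomp_apply meas_basis_eq[OF H R, symmetric] measurement_meas_basis[OF H G])
qed

text \<open>The matrix element \<open>c \<langle>b\<^sub>j|a\<^sub>i\<rangle>\<close> of \<open>c (G \<cdot> R\<^sup>\<dagger>)\<close> is the scalar in the entry \<open>(i, j)\<close> of the bent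
  2-cell.\<close>

lemma horiz_unitary_prep_meas_iff:
  assumes H: "fd_hilbert H" and R: "measurement n H R" and G: "measurement n H G"
  shows "horiz_unitary n (scale2 c (G \<cdot> R\<^sup>\<dagger>)) \<longleftrightarrow>
    (\<forall>i<n. \<forall>j<n. cmod c * cmod (inn H (meas_basis H R i) (meas_basis H G j)) = 1)"
proof -
  let ?K = "scale2 c (G \<cdot> R\<^sup>\<dagger>)" and ?V = "ent (W\<^sub>L n ;\<^sub>1 W\<^sub>R n) 0 0"
  have fdV: "fd_hilbert ?V" by (rule fd_ent[OF is_cell1_W(4)]) simp_all
  have cell: "is_cell2 (G \<cdot> R\<^sup>\<dagger>)" by (rule is_cell2_prep_meas[OF assms])
  have K: "is_cell2 ?K" "dom2 ?K = W\<^sub>L n ;\<^sub>1 W\<^sub>R n" "cod2 ?K = W\<^sub>L n ;\<^sub>1 W\<^sub>R n"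
    using is_cell2_scale2[OF cell] measurement_cell[OF H R] measurement_cell[OF H G] by simp_all
  have bend: "map2 (bend n ?K) i j (std_vec 0) =
      (c * inn H (meas_basis H G j) (meas_basis H R i)) *\<^sub>C std_vec 0" if i: "i < n" and j: "j < n" for i j
  proof -
    have "map2 (G \<cdot> R\<^sup>\<dagger>) 0 0 (std_vec i) \<in> carr ?V"
      using linear_maps_carr[OF is_cell2_map[OF cell, of 0 0]] std_vec_carr_WL_WR[OF i]
        measurement_cell[OF H R] measurement_cell[OF H G] by simp
    from inn_scale_right[OF fdV std_vec_carr_WL_WR[OF j] this, of c] show ?thesis
      using bend_apply[OF K i j] prep_meas_entry[OF assms i j] by (simp only: scale2_apply)
  qed
  have "cmod (inn H (meas_basis H G j) (meas_basis H R i)) = cmod (inn H (meas_basis H R i) (meas_basis H G j))"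
    if "i < n" "j < n" for i j
    using inn_cnj[OF H meas_basis_carr[OF H R that(1)] meas_basis_carr[OF H G that(2)]] by simp
  then show ?thesis unfolding horiz_unitary_def
    by (subst unitary2_entrywise_scalar[of _ n, OF is_cell2_bend[OF K] _ _ bend])
      (auto simp: norm_mult)
qed

theorem theorem4p6:
  fixes H :: "'h::complex_vector hspace"
    and n :: nat
    and R G :: "('h, nat \<Rightarrow> complex \<Rightarrow> complex) cell2"
  assumes "fd_hilbert H"
    and "n \<ge> 1"
    and "measurement n H R"
    and "measurement n H G"
  shows "complementary n H R G \<longleftrightarrow> horiz_unitary_up_to_scalar n (G \<cdot> R\<^sup>\<dagger>)"
proof -
  let ?p = "\<lambda>i j. cmod (inn H (meas_basis H R i) (meas_basis H G j))"
  note iff = horiz_unitary_prep_meas_iff[OF assms(1,3,4)]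
  have dim: "hdim H = n" by (rule measurement_hdim[OF assms(1,3)])
  show ?thesis
  proof
    assume "complementary n H R G"
    then have "?p i j = 1 / sqrt (real n)" if "i < n" "j < n" for i j
      using that dim real_sqrt_unique[of "?p i j"] by (auto simp: complementary_def real_sqrt_divide)
    then have "horiz_unitary n (scale2 (complex_of_real (sqrt (real n))) (G \<cdot> R\<^sup>\<dagger>))"
      unfolding iff using assms(2) by simp
    then show "horiz_unitary_up_to_scalar n (G \<cdot> R\<^sup>\<dagger>)"
      unfolding horiz_unitary_up_to_scalar_def using assms(2) by (intro exI conjI) auto
  next
    assume "horiz_unitary_up_to_scalar n (G \<cdot> R\<^sup>\<dagger>)"
    then obtain c where c: "c \<noteq> 0" "\<forall>i<n. \<forall>j<n. cmod c * ?p i j = 1"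
      unfolding horiz_unitary_up_to_scalar_def iff by blast
    have p: "(?p i j)\<^sup>2 = 1 / (cmod c)\<^sup>2" if "i < n" "j < n" for i j
    proof -
      have "?p i j = 1 / cmod c" using c that by (simp add: field_simps)
      then show ?thesis by (simp add: power_divide)
    qed
    have "(?p i j)\<^sup>2 = 1 / real (hdim H)" if i: "i < n" and j: "j < n" for i j
    proof -
      \<comment> \<open>All \<open>n\<close> terms equal \<open>1 / |c|\<^sup>2\<close>, so this determines \<open>|c|\<close>.\<close>
      have "(\<Sum>i<n. (?p i j)\<^sup>2) = 1"
        using meas_basis_carr[OF assms(1,4) j] meas_basis_orthonormal[OF assms(1,4) j j]
        by (intro meas_basis_parseval[OF assms(1,3)]) simp_all
      then have "real n * (1 / (cmod c)\<^sup>2) = 1" using j by (simp add: p)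
      then show ?thesis using p[OF i j] dim assms(2) by (simp add: field_simps)
    qed
    then show "complementary n H R G" by (simp add: complementary_def)
  qed
qed

end
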